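(* Suppose $\Sigma\subset\mathbb{R}^d$ is compact and let $r>0$. If $\hat c\in\mathcal{C}_{\mathrm{DRO}}(X\times\mathcal{P}(\Sigma))$ is a reasonably feasible DRO predictor at rate $r$ associated with the ambiguity sets $\mathcal{A}(\hat P)$, then for every $\hat P\in\mathcal{P}(\Sigma)$ $$\bigcap_{\epsilon>0}\{P\in\mathcal{P}(\Sigma):D^{\epsilon}_{\mathrm{KL},W}(\hat P,P)\le r\}=\bigcap_{\epsilon>0}\{P\in\mathcal{P}(\Sigma):D^{\epsilon}_{\mathrm{KL},\mathrm{LP}}(\hat P,P)\le r\}=\{P\in\mathcal{P}(\Sigma):D_{\mathrm{KL}}(\hat P,P)\le r\}\subseteq\mathcal{A}(\hat P).$$
   Context: $X\subseteq\mathbb{R}^m$ is a nonempty set of decisions. $\mathcal{P}(\Sigma)$ is the set of Borel probability measures on $\Sigma$ with the weak topology. For a loss $\ell:X\times\Sigma\to\mathbb{R}$ put $c(x,P):=\int\ell(x,\xi)\,\mathrm{d}P(\xi)$. For $P\in\mathcal{P}(\Sigma)$, $\xi_1,\xi_2,\dots$ are i.i.d. samples from $P$, $P_N:=\frac1N\sum_{i=1}^N\delta_{\xi_i}$, and $\mathrm{Prob}$ is the probability under this sampling; $\log0=-\infty$. DRO predictors: $\mathcal{C}_{\mathrm{DRO}}(X\times\mathcal{P}(\Sigma))$ consists of predictors of the form $\hat c(x,\hat P)=\sup\{c(x,P):P\in\mathcal{A}(\hat P)\}$, where for each $\hat P\in\mathcal{P}(\Sigma)$ the ambiguity set $\mathcal{A}(\hat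 P)\subseteq\mathcal{P}(\Sigma)$ is nonempty, (weakly) closed and convex, depends only on $\hat P$ and not on the loss function, and where $\hat P\mapsto\hat c(x,\hat P)$ is upper semicontinuous for each $x\in X$. Thus a fixed ambiguity map $\mathcal{A}$ yields a predictor $\hat c$ for each loss function, and the upper semicontinuity is required for the losses under consideration, in particular for all decision-free losses. A loss is decision-free if $\ell(x,\xi)\equiv\ell_0(\xi)$ for some continuous $\ell_0:\Sigma\to\mathbb{R}$. A DRO predictor is reasonably feasible at rate $r$ if, for every decision-free loss $\ell$, $\sup_{P\in\mathcal{P}(\Sigma)}\limsup_{N\to\infty}\frac1N\log\mathrm{Prob}[\exists x\in X:c(x,P)>\hat c(x,P_N)]\le-r$. $W(P',P)=\inf\{\int\|\xi'-\xi\|\,\mathrm{d}\gamma(\xi',\xi):\gamma\in\Gamma(P',P)\}$ is the Wasserstein distance ($\Gamma(P',P)$: couplings of $P'$ and $P$). $\mathrm{LP}(P',P)=\inf\{\epsilon>0: P(S)\le P'(S^\epsilon)+\epsilon,\ P'(S)\le P(S^\epsilon)+\epsilon\ \text{for all Borel } S\subseteq\Sigma\}$, with $S^\epsilon=\{\xi'\in\Sigma:\|\xi'-\xi\|\le\epsilon\text{ for some }\xi\in S\}$. $D_{\mathrm{KL}}(P',P)=\int\log\frac{\mathrm{d}P'}{\mathrm{d}P}\,\mathrm{d}P'$ if $P'\ll P$ and $+\infty$ otherwise. $D^{\epsilon}_{\mathrm{KL},W}(P',P)=\inf\{D_{\mathrm{KL}}(Q,P):Q\in\mathcal{P}(\Sigma),\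 W(P',Q)\le\epsilon\}$ and $D^{\epsilon}_{\mathrm{KL},\mathrm{LP}}(P',P)=\inf\{D_{\mathrm{KL}}(Q,P):Q\in\mathcal{P}(\Sigma),\ \mathrm{LP}(P',Q)\le\epsilon\}$. *)

theory Defs
  imports "HOL-Probability.Probability"
begin

section \<open>Borel probability measures on a set and the weak topology\<close>

abbreviation borel_on :: "'a::topological_space set \<Rightarrow> 'a measure"
  where "borel_on \<Sigma> \<equiv> restrict_space borel \<Sigma>"

definition prob_measures :: "'a::topological_space set \<Rightarrow> 'a measure set"
  where "prob_measures \<Sigma> = {P. prob_space P \<and> sets P = sets (borel_on \<Sigma>)}"

text \<open>The coarsest topology on the probability measures for which \<open>P \<mapsto> \<integral>f dP\<close> is continuous for
  every bounded continuous \<open>f\<close> on \<open>\<Sigma>\<close>.\<close>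

definition weak_topology :: "'a::topological_space set \<Rightarrow> 'a measure topology"
  where "weak_topology \<Sigma> = topology_generated_by
    {{P \<in> prob_measures \<Sigma>. (\<integral>\<xi>. f \<xi> \<partial>P) \<in> U} | (f :: 'a \<Rightarrow> real) U.
      continuous_on \<Sigma> f \<and> bounded (f ` \<Sigma>) \<and> open U}"

lemma topspace_weak_topology [simp]: "topspace (weak_topology \<Sigma>) = prob_measures \<Sigma>"
proof -
  have "prob_measures \<Sigma> = {P \<in> prob_measures \<Sigma>. (\<integral>\<xi>. (0::real) \<partial>P) \<in> UNIV}"
    by simp
  moreover have "continuous_on \<Sigma> (\<lambda>_. 0::real)" "bounded ((\<lambda>_. 0::real) ` \<Sigma>)"
    by (auto intro: finite_imp_bounded finite_subset[of _ "{0}"])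
  ultimately have "prob_measures \<Sigma> \<subseteq> topspace (weak_topology \<Sigma>)"
    unfolding weak_topology_def topology_generated_by_topspace by blast
  moreover have "topspace (weak_topology \<Sigma>) \<subseteq> prob_measures \<Sigma>"
    unfolding weak_topology_def topology_generated_by_topspace by blast
  ultimately show ?thesis by blast
qed

definition upper_semicontinuous_map :: "'b topology \<Rightarrow> ('b \<Rightarrow> ereal) \<Rightarrow> bool"
  where "upper_semicontinuous_map T f \<longleftrightarrow> (\<forall>a. openin T {p \<in> topspace T. f p < a})"

definition mixture :: "real \<Rightarrow> 'a measure \<Rightarrow> 'a measure \<Rightarrow> 'a measure"
  where "mixture t P Q = measure_of (space P) (sets P)
    (\<lambda>S. ennreal (1 - t) * emeasure P S + ennreal t * emeasure Q S)"

lemma emeasure_mixture: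
  assumes "sets Q = sets P" "S \<in> sets P"
  shows "emeasure (mixture t P Q) S = ennreal (1 - t) * emeasure P S + ennreal t * emeasure Q S"
  unfolding mixture_def
proof (rule emeasure_measure_of_sigma)
  show "sigma_algebra (space P) (sets P)" by (rule sets.sigma_algebra_axioms)
  show "countably_additive (sets P)
    (\<lambda>S. ennreal (1 - t) * emeasure P S + ennreal t * emeasure Q S)"
  proof (rule countably_additiveI)
    fix A :: "nat \<Rightarrow> 'a set"
    assume A: "range A \<subseteq> sets P" "disjoint_family A"
    then show "(\<Sum>i. ennreal (1 - t) * emeasure P (A i) + ennreal t * emeasure Q (A i)) =
      ennreal (1 - t) * emeasure P (\<Union>i. A i) + ennreal t * emeasure Q (\<Union>i. A i)"
      using assms(1) by (simp add: suminf_add[symmetric] suminf_emeasure)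
  qed
qed (use assms in \<open>auto simp: positive_def\<close>)

lemma mixture_in_prob_measures:
  assumes "P \<in> prob_measures \<Sigma>" "Q \<in> prob_measures \<Sigma>" "0 \<le> t" "t \<le> 1"
  shows "mixture t P Q \<in> prob_measures \<Sigma>"
proof -
  have s: "sets Q = sets P" "sets P = sets (borel_on \<Sigma>)"
    using assms by (auto simp: prob_measures_def)
  have 1: "emeasure P (space P) = 1" "emeasure Q (space Q) = 1"
    using assms by (auto simp: prob_measures_def prob_space.emeasure_space_1)
  have sp: "space (mixture t P Q) = space P" "sets (mixture t P Q) = sets P"
    by (simp_all add: mixture_def)
  have "emeasure (mixture t P Q) (space P) = ennreal (1 - t) + ennreal t"
    using 1 sets_eq_imp_space_eq[OF s(1)] by (simp add: emeasure_mixture[OF s(1)])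
  also have "\<dots> = 1" using assms by (simp add: ennreal_plus[symmetric] del: ennreal_plus)
  finally have "prob_space (mixture t P Q)" by (intro prob_spaceI) (simp add: sp)
  then show ?thesis using s sp by (simp add: prob_measures_def)
qed

definition convex_measures :: "'a measure set \<Rightarrow> bool"
  where "convex_measures \<A> \<longleftrightarrow> (\<forall>P\<in>\<A>. \<forall>Q\<in>\<A>. \<forall>t\<in>{0..1}. mixture t P Q \<in> \<A>)"

section \<open>Sampling\<close>

definition empirical_measure :: "'a::topological_space set \<Rightarrow> nat \<Rightarrow> (nat \<Rightarrow> 'a) \<Rightarrow> 'a measure"
  where "empirical_measure \<Sigma> N \<xi> = distr (uniform_count_measure {..<N}) (borel_on \<Sigma>) \<xi>"

lemma emeasure_empirical_measure:
  assumes "N > 0" "\<And>i. i < N \<Longrightarrow> \<xi> i \<in> \<Sigma>" "S \<in> sets (borel_on \<Sigma>)"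
  shows "emeasure (empirical_measure \<Sigma> N \<xi>) S = ennreal ((\<Sum>i<N. indicator S (\<xi> i)) / real N)"
proof -
  have m: "\<xi> \<in> measurable (uniform_count_measure {..<N}) (borel_on \<Sigma>)"
    using assms(2) by (auto simp: measurable_def sets_uniform_count_measure
      space_uniform_count_measure space_restrict_space)
  have "(\<Sum>i<N. indicator S (\<xi> i) :: real) = card (\<xi> -` S \<inter> {..<N})"
    by (simp add: indicator_def sum.If_cases Int_def conj_commute)
  then show ?thesis
    using assms unfolding empirical_measure_def
    by (simp add: emeasure_distr[OF m] space_uniform_count_measure emeasure_uniform_count_measure
        ennreal_of_nat_eq_real_of_nat divide_ennreal)
qed

text \<open>The canonical space of i.i.d. sequences \<open>\<xi>\<^sub>1, \<xi>\<^sub>2, \<dots>\<close> with law \<open>P\<close>; sample indices start at 0.\<close>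

definition iid_samples :: "'a measure \<Rightarrow> (nat \<Rightarrow> 'a) measure"
  where "iid_samples P = PiM UNIV (\<lambda>_. P)"

definition log_prob :: "real \<Rightarrow> ereal"
  where "log_prob p = (if p = 0 then -\<infinity> else ereal (ln p))"

section \<open>Predictors\<close>

definition cost :: "('x \<Rightarrow> 'a \<Rightarrow> real) \<Rightarrow> 'x \<Rightarrow> 'a measure \<Rightarrow> real"
  where "cost l x P = (\<integral>\<xi>. l x \<xi> \<partial>P)"

definition decision_free :: "'x set \<Rightarrow> 'a::topological_space set \<Rightarrow> ('x \<Rightarrow> 'a \<Rightarrow> real) set"
  where "decision_free X \<Sigma> =
    {l. \<exists>l0. continuous_on \<Sigma> l0 \<and> (\<forall>x\<in>X. \<forall>\<xi>\<in>\<Sigma>. l x \<xi> = l0 \<xi>)}"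

text \<open>The losses under consideration: any class for which the cost \<open>\<integral>l x dP\<close> is always well defined
  and which contains all decision-free losses.\<close>

definition loss_class :: "'x set \<Rightarrow> 'a::topological_space set \<Rightarrow> ('x \<Rightarrow> 'a \<Rightarrow> real) set \<Rightarrow> bool"
  where "loss_class X \<Sigma> L \<longleftrightarrow> decision_free X \<Sigma> \<subseteq> L \<and>
    (\<forall>l\<in>L. \<forall>x\<in>X. \<forall>P\<in>prob_measures \<Sigma>. integrable P (l x))"

text \<open>\<open>c\<close> is the predictor (one for each loss) associated with the ambiguity map \<open>\<A>\<close>, which does
  not depend on the loss.\<close>

definition DRO_predictor ::
    "'x set \<Rightarrow> 'a::topological_space set \<Rightarrow> ('x \<Rightarrow> 'a \<Rightarrow> real) set \<Rightarrow>
     ('a measure \<Rightarrow> 'a measure set) \<Rightarrow>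
     (('x \<Rightarrow> 'a \<Rightarrow> real) \<Rightarrow> 'x \<Rightarrow> 'a measure \<Rightarrow> ereal) \<Rightarrow> bool"
  where "DRO_predictor X \<Sigma> L \<A> c \<longleftrightarrow>
    (\<forall>P'\<in>prob_measures \<Sigma>.
       \<A> P' \<noteq> {} \<and> \<A> P' \<subseteq> prob_measures \<Sigma> \<and>
       closedin (weak_topology \<Sigma>) (\<A> P') \<and> convex_measures (\<A> P')) \<and>
    (\<forall>l\<in>L. \<forall>x\<in>X.
       (\<forall>P'\<in>prob_measures \<Sigma>. c l x P' = (SUP P\<in>\<A> P'. ereal (cost l x P))) \<and>
       upper_semicontinuous_map (weak_topology \<Sigma>) (c l x))"

definition reasonably_feasible ::
    "'x set \<Rightarrow> 'a::topological_space set \<Rightarrow> real \<Rightarrow>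
     (('x \<Rightarrow> 'a \<Rightarrow> real) \<Rightarrow> 'x \<Rightarrow> 'a measure \<Rightarrow> ereal) \<Rightarrow> bool"
  where "reasonably_feasible X \<Sigma> r c \<longleftrightarrow>
    (\<forall>l\<in>decision_free X \<Sigma>.
       (SUP P\<in>prob_measures \<Sigma>. limsup (\<lambda>N.
          ereal (1 / real N) * log_prob (measure (iid_samples P)
            {\<xi> \<in> space (iid_samples P).
               \<exists>x\<in>X. ereal (cost l x P) > c l x (empirical_measure \<Sigma> N \<xi>)})))
       \<le> - ereal r)"

section \<open>Distances and divergences\<close>

definition couplings ::
    "'a::topological_space set \<Rightarrow> 'a measure \<Rightarrow> 'a measure \<Rightarrow> ('a \<times> 'a) measure set"
  where "couplings \<Sigma> P' P = {\<gamma>. sets \<gamma> = sets (borel_on \<Sigma> \<Otimes>\<^sub>M borel_on \<Sigma>) \<and>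
    distr \<gamma> (borel_on \<Sigma>) fst = P' \<and> distr \<gamma> (borel_on \<Sigma>) snd = P}"

definition wasserstein ::
    "'a::euclidean_space set \<Rightarrow> 'a measure \<Rightarrow> 'a measure \<Rightarrow> ennreal"
  where "wasserstein \<Sigma> P' P =
    (INF \<gamma>\<in>couplings \<Sigma> P' P. \<integral>\<^sup>+(\<xi>', \<xi>). ennreal (norm (\<xi>' - \<xi>)) \<partial>\<gamma>)"

definition thickening :: "'a::euclidean_space set \<Rightarrow> real \<Rightarrow> 'a set \<Rightarrow> 'a set"
  where "thickening \<Sigma> \<epsilon> S = {\<xi>'\<in>\<Sigma>. \<exists>\<xi>\<in>S. norm (\<xi>' - \<xi>) \<le> \<epsilon>}"

text \<open>For Borel \<open>S\<close> the thickening is an analytic set, hence universally measurable, but it need not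
  be Borel. Its measure is therefore taken to be the outer measure, which on such sets is the value
  of the completed measure; \<open>emeasure\<close> would return 0 on a set that is not Borel.\<close>

definition levy_prokhorov ::
    "'a::euclidean_space set \<Rightarrow> 'a measure \<Rightarrow> 'a measure \<Rightarrow> real"
  where "levy_prokhorov \<Sigma> P' P = Inf {\<epsilon>. \<epsilon> > 0 \<and> (\<forall>S\<in>sets (borel_on \<Sigma>).
    emeasure P S \<le> outer_measure_of P' (thickening \<Sigma> \<epsilon> S) + ennreal \<epsilon> \<and>
    emeasure P' S \<le> outer_measure_of P (thickening \<Sigma> \<epsilon> S) + ennreal \<epsilon>)}"

text \<open>The reference measure comes first in \<open>KL_divergence\<close> and \<open>absolutely_continuous\<close>.
  For \<open>P' \<lless> P\<close> the negative part of \<open>log (dP'/dP)\<close> is always \<open>P'\<close>-integrable, so the integral is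
  \<open>+\<infinity>\<close> exactly when \<open>log (dP'/dP)\<close> is not \<open>P'\<close>-integrable.\<close>

definition KL :: "'a measure \<Rightarrow> 'a measure \<Rightarrow> ereal"
  where "KL P' P =
    (if absolutely_continuous P P' \<and> integrable P' (entropy_density (exp 1) P P')
     then ereal (KL_divergence (exp 1) P P') else \<infinity>)"

definition KL_W ::
    "'a::euclidean_space set \<Rightarrow> real \<Rightarrow> 'a measure \<Rightarrow> 'a measure \<Rightarrow> ereal"
  where "KL_W \<Sigma> \<epsilon> P' P =
    (INF Q\<in>{Q \<in> prob_measures \<Sigma>. wasserstein \<Sigma> P' Q \<le> ennreal \<epsilon>}. KL Q P)"

definition KL_LP ::
    "'a::euclidean_space set \<Rightarrow> real \<Rightarrow> 'a measure \<Rightarrow> 'a measure \<Rightarrow> ereal"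
  where "KL_LP \<Sigma> \<epsilon> P' P =
    (INF Q\<in>{Q \<in> prob_measures \<Sigma>. levy_prokhorov \<Sigma> P' Q \<le> \<epsilon>}. KL Q P)"

end

theory Submission
  imports Defs
begin

text \<open>
  By the Donsker--Varadhan formula, \<open>KL(\<cdot>, P)\<close> is the supremum of the functionals
  \<open>Q \<mapsto> \<integral>f dQ - log \<integral>exp f dP\<close> over bounded Lipschitz functions \<open>f\<close>. Each of these is continuous for
  the Wasserstein and for the Levy--Prokhorov distance, so the neighbourhoods of \<open>P'\<close> in the smoothed
  divergences shrink to \<open>P'\<close> itself. If \<open>KL(P', P) \<le> r\<close> but \<open>P \<notin> \<A>(P')\<close>, a continuous loss separates
  \<open>P\<close> from the closed convex set \<open>\<A>(P')\<close>. By upper semicontinuity the predictor for this loss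
  underestimates the cost under \<open>P\<close> on a whole weak neighbourhood of \<open>P'\<close>. That neighbourhood contains
  some \<open>Q\<close> with \<open>KL(Q, P) < r\<close>, so the lower bound of Sanov's theorem makes the probability of
  disappointment decay at a rate slower than \<open>r\<close>.
\<close>

section \<open>The weak topology\<close>

text \<open>The variational formula needs two classes of test functions. Recovering the divergence
  takes truncated logarithms of a density, which are merely measurable, while closeness in either
  distance is felt only by functions with a modulus of continuity. Lipschitz functions are dense in
  L1 of the average of the two measures involved, and both sides of the inequality are L1-continuous
  among uniformly bounded functions, so the inequality passes from one class to the other.

  In the sampling argument the obstacle is the boundary case \<open>KL P' P = r\<close>: tilting
  towards \<open>P'\<close> itself gives a rate no better than \<open>r\<close>, which contradicts
  nothing. Moving from \<open>P'\<close> towards \<open>P\<close> scales the divergence bound by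
  \<open>1 - t\<close>, a strict gain as \<open>r > 0\<close>. A density bounded from both sides has
  a bounded logarithm, so Hoeffding's inequality supplies every law of large numbers.

  Since \<open>measure\<close> is 0 outside the sigma-algebra, the event of disappointment must also
  be shown measurable before its probability can be bounded from below.\<close>

lemma prob_measuresD:
  assumes "P \<in> prob_measures \<Sigma>"
  shows "prob_space P" "sets P = sets (borel_on \<Sigma>)" "space P = \<Sigma>"
  using assms sets_eq_imp_space_eq[of P "borel_on \<Sigma>"]
  by (auto simp: prob_measures_def space_restrict_space)

lemma continuous_on_measurable_prob_measures:
  fixes f :: "'a::topological_space \<Rightarrow> real"
  assumes "P \<in> prob_measures \<Sigma>" "continuous_on \<Sigma> f"
  shows "f \<in> borel_measurable P"
  using borel_measurable_continuous_on_restrict[OF assms(2)] prob_measuresD(2)[OF assms(1)]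
  by (simp cong: measurable_cong_sets)

lemma integrable_bounded_prob_measures:
  fixes f :: "'a::topological_space \<Rightarrow> real"
  assumes "P \<in> prob_measures \<Sigma>" "f \<in> borel_measurable P" "bounded (f ` \<Sigma>)"
  shows "integrable P f"
proof -
  interpret prob_space P using prob_measuresD(1)[OF assms(1)] .
  obtain B where "\<forall>x\<in>\<Sigma>. norm (f x) \<le> B"
    using assms(3) unfolding bounded_iff by auto
  then show ?thesis
    using prob_measuresD(3)[OF assms(1)] assms(2) by (intro integrable_const_bound[of _ B]) auto
qed

lemma integrable_continuous_prob_measures:
  fixes f :: "'a::topological_space \<Rightarrow> real"
  assumes "P \<in> prob_measures \<Sigma>" "continuous_on \<Sigma> f" "bounded (f ` \<Sigma>)"
  shows "integrable P f"
  using assms continuous_on_measurable_prob_measures integrable_bounded_prob_measures by blast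

text \<open>Finite intersections are the only way in which generators combine to smaller open sets,
  so finitely many functions and one common radius are enough. Through this base, separation and
  concentration become statements about finitely many integrals.\<close>

lemma weak_topology_nbhdE:
  fixes \<Sigma> :: "'a::topological_space set"
  assumes "openin (weak_topology \<Sigma>) G" "P \<in> G"
  obtains F :: "('a \<Rightarrow> real) set" and d where "finite F" "d > 0"
    "\<And>f. f \<in> F \<Longrightarrow> continuous_on \<Sigma> f \<and> bounded (f ` \<Sigma>)"
    "\<And>Q. Q \<in> prob_measures \<Sigma> \<Longrightarrow> (\<And>f. f \<in> F \<Longrightarrow> \<bar>(\<integral>x. f x \<partial>Q) - (\<integral>x. f x \<partial>P)\<bar> < d) \<Longrightarrow> Q \<in> G"
proof -
  define close where "close P F d Q \<longleftrightarrow> (\<forall>f\<in>F. \<bar>(\<integral>x. f x \<partial>Q) - (\<integral>x. f x \<partial>P)\<bar> < d)"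
    for P Q and F :: "('a \<Rightarrow> real) set" and d
  define ok where "ok F \<longleftrightarrow> finite F \<and> (\<forall>f\<in>F. continuous_on \<Sigma> f \<and> bounded (f ` \<Sigma>))"
    for F :: "('a \<Rightarrow> real) set"
  have mono: "close P F d Q" if "close P F' d' Q" "F \<subseteq> F'" "d' \<le> d" for P F d F' d' Q
    using that unfolding close_def by fastforce
  have "generate_topology_on {{P \<in> prob_measures \<Sigma>. (\<integral>\<xi>. f \<xi> \<partial>P) \<in> U} | (f :: 'a \<Rightarrow> real) U.
      continuous_on \<Sigma> f \<and> bounded (f ` \<Sigma>) \<and> open U} G"
    using assms(1) unfolding weak_topology_def openin_topology_generated_by_iff .
  then have "\<exists>F d. ok F \<and> d > 0 \<and> (\<forall>Q\<in>prob_measures \<Sigma>. close P F d Q \<longrightarrow> Q \<in> G)"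
    using assms(2)
  proof (induction arbitrary: P)
    case Empty
    then show ?case by simp
  next
    case (Int a b)
    obtain F d where 1: "ok F" "d > 0" "\<forall>Q\<in>prob_measures \<Sigma>. close P F d Q \<longrightarrow> Q \<in> a"
      using Int.IH(1)[of P] Int.prems by blast
    obtain F' d' where 2: "ok F'" "d' > 0" "\<forall>Q\<in>prob_measures \<Sigma>. close P F' d' Q \<longrightarrow> Q \<in> b"
      using Int.IH(2)[of P] Int.prems by blast
    have "ok (F \<union> F')" using 1 2 by (auto simp: ok_def)
    moreover have "\<forall>Q\<in>prob_measures \<Sigma>. close P (F \<union> F') (min d d') Q \<longrightarrow> Q \<in> a \<inter> b"
      using 1(3) 2(3) mono[of P "F \<union> F'" "min d d'"] by auto
    ultimately show ?case using 1(2) 2(2) by (metis min_less_iff_conj)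
  next
    case (UN K)
    then obtain k where k: "k \<in> K" "P \<in> k" by blast
    obtain F d where "ok F" "d > 0" "\<forall>Q\<in>prob_measures \<Sigma>. close P F d Q \<longrightarrow> Q \<in> k"
      using UN.IH[OF k] by blast
    then show ?case using k(1) by blast
  next
    case (Basis s)
    then obtain f :: "'a \<Rightarrow> real" and U where s: "s = {P \<in> prob_measures \<Sigma>. (\<integral>\<xi>. f \<xi> \<partial>P) \<in> U}"
      "continuous_on \<Sigma> f" "bounded (f ` \<Sigma>)" "open U" by blast
    then obtain e where e: "e > 0" "\<And>y. dist y (\<integral>\<xi>. f \<xi> \<partial>P) < e \<Longrightarrow> y \<in> U"
      using Basis.prems unfolding open_dist by blast
    have "ok {f}" using s by (simp add: ok_def)
    moreover have "\<forall>Q\<in>prob_measures \<Sigma>. close P {f} e Q \<longrightarrow> Q \<in> s"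
      using e(2) s(1) by (auto simp: close_def dist_real_def)
    ultimately show ?case using e(1) by blast
  qed
  then obtain F d where "ok F" "d > 0" "\<forall>Q\<in>prob_measures \<Sigma>. close P F d Q \<longrightarrow> Q \<in> G"
    by blast
  then show ?thesis by (intro that[of F d]) (simp_all add: ok_def close_def)
qed

section \<open>Integration against mixtures, and separation of a measure from a weakly closed convex
  set\<close>

lemma sets_mixture [simp, measurable_cong]: "sets (mixture t P Q) = sets P"
  and space_mixture [simp]: "space (mixture t P Q) = space P"
  by (simp_all add: mixture_def)

text \<open>\<open>mixture\<close> is given by its values on sets only, so its integral is built up
  by the standard induction over nonnegative measurable functions.\<close>

lemma nn_integral_mixture:
  assumes sQ: "sets Q = sets P" and "f \<in> borel_measurable P"
  shows "(\<integral>\<^sup>+x. f x \<partial>mixture t P Q) = ennreal (1 - t) * (\<integral>\<^sup>+x. f x \<partial>P) + ennreal t * (\<integral>\<^sup>+x. f x \<partial>Q)"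
  using assms(2)
proof (induction rule: borel_measurable_induct)
  case (cong f g)
  then show ?case
    using sets_eq_imp_space_eq[OF sQ] by (simp cong: nn_integral_cong_simp)
next
  case (set A)
  then show ?case using sQ by (simp add: emeasure_mixture)
next
  case (mult u c)
  note [measurable_cong] = sQ
  from mult show ?case
    by (simp add: nn_integral_cmult distrib_left mult_ac)
next
  case (add u v)
  note [measurable_cong] = sQ
  from add show ?case
    by (simp add: nn_integral_add distrib_left ac_simps)
next
  case (seq U)
  note [measurable_cong] = sQ
  note [measurable] = seq.hyps(1)
  have mono: "\<And>c M. incseq (\<lambda>i. ennreal c * (\<integral>\<^sup>+x. U i x \<partial>M))"
    using seq.hyps(3) by (auto simp: incseq_def le_fun_def intro!: mult_left_mono nn_integral_mono)
  have "(\<integral>\<^sup>+x. (SUP i. U i x) \<partial>mixture t P Q) = (SUP i. \<integral>\<^sup>+x. U i x \<partial>mixture t P Q)"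
    using seq.hyps(3) by (intro nn_integral_monotone_convergence_SUP) auto
  also have "\<dots> = (SUP i. ennreal (1 - t) * (\<integral>\<^sup>+x. U i x \<partial>P)) + (SUP i. ennreal t * (\<integral>\<^sup>+x. U i x \<partial>Q))"
    by (simp add: seq.IH ennreal_SUP_add mono)
  also have "\<dots> = ennreal (1 - t) * (\<integral>\<^sup>+x. (SUP i. U i x) \<partial>P) + ennreal t * (\<integral>\<^sup>+x. (SUP i. U i x) \<partial>Q)"
    using seq.hyps(3) by (simp add: nn_integral_monotone_convergence_SUP SUP_mult_left_ennreal)
  finally show ?case by (simp add: image_comp)
qed

lemma integral_mixture:
  fixes f :: "'a \<Rightarrow> real"
  assumes sQ: "sets Q = sets P" and "integrable P f" "integrable Q f" and t: "0 \<le> t" "t \<le> 1"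
  shows "(\<integral>x. f x \<partial>mixture t P Q) = (1 - t) * (\<integral>x. f x \<partial>P) + t * (\<integral>x. f x \<partial>Q)"
proof -
  have m: "f \<in> borel_measurable P" using assms by auto
  have fin: "(\<integral>\<^sup>+x. ennreal (f x) \<partial>M) \<noteq> \<infinity>" "(\<integral>\<^sup>+x. ennreal (- f x) \<partial>M) \<noteq> \<infinity>" 
    if "integrable M f" for M :: "'a measure"
    using that by (auto simp: real_integrable_def)
  have nn: "enn2real (\<integral>\<^sup>+x. ennreal (g x) \<partial>mixture t P Q) =
      (1 - t) * enn2real (\<integral>\<^sup>+x. ennreal (g x) \<partial>P) + t * enn2real (\<integral>\<^sup>+x. ennreal (g x) \<partial>Q)"
    if "g \<in> borel_measurable P" "(\<integral>\<^sup>+x. ennreal (g x) \<partial>P) \<noteq> \<infinity>" "(\<integral>\<^sup>+x. ennreal (g x) \<partial>Q) \<noteq> \<infinity>"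
    for g :: "'a \<Rightarrow> real"
    using that t
    by (subst nn_integral_mixture[OF sQ])
      (auto simp: enn2real_plus enn2real_mult ennreal_mult_less_top less_top)
  have im: "integrable (mixture t P Q) f"
    using m fin[OF assms(2)] fin[OF assms(3)]
    by (auto simp: real_integrable_def nn_integral_mixture[OF sQ] ennreal_mult_eq_top_iff)
  show ?thesis
    unfolding real_lebesgue_integral_def[OF im] real_lebesgue_integral_def[OF assms(2)]
      real_lebesgue_integral_def[OF assms(3)]
    using nn[of f] nn[of "\<lambda>x. - f x"] m fin[OF assms(2)] fin[OF assms(3)]
    by (simp add: algebra_simps)
qed

text \<open>This is nearest-point separation in a finite-dimensional space. A basic neighbourhood of
  \<open>P\<close> that avoids \<open>A\<close> involves a finite set \<open>F\<close> of functions;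
  the integrals over \<open>F\<close> map \<open>A\<close> to a convex subset of Euclidean space
  that stays at a positive distance from the image of \<open>P\<close>. The normal vector at an
  almost nearest point gives the coefficients of the separating function.\<close>

lemma weak_separation:
  fixes \<Sigma> :: "'a::topological_space set"
  assumes conv: "convex_measures A" and sub: "A \<subseteq> prob_measures \<Sigma>" and ne: "A \<noteq> {}"
    and cl: "closedin (weak_topology \<Sigma>) A" and P: "P \<in> prob_measures \<Sigma>" "P \<notin> A"
  obtains f :: "'a \<Rightarrow> real" and m where "continuous_on \<Sigma> f" "bounded (f ` \<Sigma>)" "m > 0"
    "\<And>Q. Q \<in> A \<Longrightarrow> (\<integral>x. f x \<partial>Q) + m \<le> (\<integral>x. f x \<partial>P)"
proof -
  have "openin (weak_topology \<Sigma>) (prob_measures \<Sigma> - A)"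
    using openin_diff[OF openin_topspace cl] by simp
  then obtain F :: "('a \<Rightarrow> real) set" and d where F: "finite F" and d: "d > 0"
    and cF: "\<And>f. f \<in> F \<Longrightarrow> continuous_on \<Sigma> f \<and> bounded (f ` \<Sigma>)"
    and nb: "\<And>Q. Q \<in> prob_measures \<Sigma> \<Longrightarrow> (\<And>f. f \<in> F \<Longrightarrow> \<bar>(\<integral>x. f x \<partial>Q) - (\<integral>x. f x \<partial>P)\<bar> < d) \<Longrightarrow>
      Q \<in> prob_measures \<Sigma> - A"
    using P by (elim weak_topology_nbhdE) auto
  have int: "integrable Q f" if "Q \<in> prob_measures \<Sigma>" "f \<in> F" for Q f
    using that cF integrable_continuous_prob_measures by blast
  define T where "T f Q = (\<integral>x. f x \<partial>Q)" for f :: "'a \<Rightarrow> real" and Q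
  \<comment> \<open>\<open>T\<close> supplies the coordinates of a measure, and \<open>D\<close> is
    the squared Euclidean distance to the image of \<open>P\<close>.\<close>
  define D where "D Q = (\<Sum>f\<in>F. (T f P - T f Q)\<^sup>2)" for Q
  define m where "m = Inf (D ` A)"
  have Dd: "d\<^sup>2 \<le> D Q" if "Q \<in> A" for Q
  proof -
    have "\<exists>f\<in>F. d \<le> \<bar>T f Q - T f P\<bar>"
    proof (rule ccontr)
      assume "\<not> (\<exists>f\<in>F. d \<le> \<bar>T f Q - T f P\<bar>)"
      then have "\<bar>(\<integral>x. f x \<partial>Q) - (\<integral>x. f x \<partial>P)\<bar> < d" if "f \<in> F" for f
        using that unfolding T_def by (simp add: not_le)
      then show False using nb[of Q] \<open>Q \<in> A\<close> sub by blast
    qed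
    then obtain f where f: "f \<in> F" "d \<le> \<bar>T f Q - T f P\<bar>" by blast
    have "d\<^sup>2 \<le> (T f P - T f Q)\<^sup>2"
      using power_mono[OF f(2), of 2] d by (simp add: power2_commute)
    also have "\<dots> \<le> D Q"
      unfolding D_def using F f(1) by (intro member_le_sum) auto
    finally show ?thesis .
  qed
  have bdd: "bdd_below (D ` A)" using Dd by (intro bdd_belowI2[of _ "d\<^sup>2"]) auto
  have m0: "m > 0"
    proof -
    have "d\<^sup>2 \<le> m" unfolding m_def using Dd ne by (intro cInf_greatest) auto
    then show ?thesis using d by (smt (verit) zero_less_power)
  qed
  have mD: "m \<le> D Q" if "Q \<in> A" for Q
    unfolding m_def using that bdd by (intro cInf_lower) auto
  have "\<forall>f\<in>F. \<exists>B. \<forall>x\<in>\<Sigma>. \<bar>f x\<bar> \<le> B"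
    using cF unfolding bounded_iff by auto
  then obtain B where B: "\<And>f x. f \<in> F \<Longrightarrow> x \<in> \<Sigma> \<Longrightarrow> \<bar>f x\<bar> \<le> B f" by metis
  have TB: "\<bar>T f Q\<bar> \<le> B f" if "f \<in> F" "Q \<in> A" for f Q
  proof -
    have Q: "Q \<in> prob_measures \<Sigma>" using that sub by auto
    interpret prob_space Q using prob_measuresD(1)[OF Q] .
    have "norm (T f Q) \<le> (\<integral>x. norm (f x) \<partial>Q)" unfolding T_def by (rule integral_norm_bound)
    also have "\<dots> \<le> B f"
      using B[OF that(1)] int[OF Q that(1)] prob_measuresD(3)[OF Q]
      by (intro integral_le_const) auto
    finally show ?thesis by simp
  qed
  \<comment> \<open>A bound for the squared diameter of the image of \<open>A\<close>; the summand 1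
    makes it positive, since the step length divides by it.\<close>
  define K where "K = (\<Sum>f\<in>F. (2 * B f)\<^sup>2) + 1"
  have K: "(\<Sum>f\<in>F. (T f R - T f Q)\<^sup>2) \<le> K" if "Q \<in> A" "R \<in> A" for Q R
  proof -
    have "(\<Sum>f\<in>F. (T f R - T f Q)\<^sup>2) \<le> (\<Sum>f\<in>F. (2 * B f)\<^sup>2)"
    proof (intro sum_mono)
      fix f assume f: "f \<in> F"
      have "\<bar>T f R - T f Q\<bar> \<le> 2 * B f" using TB[OF f] that by (smt (verit))
      from power_mono[OF this, of 2] show "(T f R - T f Q)\<^sup>2 \<le> (2 * B f)\<^sup>2" by simp
    qed
    then show ?thesis by (simp add: K_def)
  qed
  have K0: "K > 0" unfolding K_def by (intro add_nonneg_pos sum_nonneg) auto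
  \<comment> \<open>The step length along a segment inside \<open>A\<close>. The quadratic term of
    \<open>D\<close> on that segment is at most \<open>s^2 * K\<close>, which this choice makes at
    most \<open>s * m / 2\<close>; the cap 1 keeps \<open>s\<close> a mixture weight.\<close>
  define s where "s = min 1 (m / (2 * K))"
  have s: "0 < s" "s \<le> 1" "s * K \<le> m / 2"
  proof -
    show "0 < s" "s \<le> 1" using m0 K0 by (auto simp: s_def)
    have "s * K \<le> m / (2 * K) * K" using K0 by (intro mult_right_mono) (auto simp: s_def)
    then show "s * K \<le> m / 2" using K0 by simp
  qed
  text \<open>A measure in \<open>A\<close> that nearly minimises the distance to \<open>P\<close> suffices to define the
    separating functional, so that no minimiser has to exist.\<close>
  obtain Y where Y: "Y \<in> A" "D Y < m + s * m / 2"
    using cInf_lessD[of "D ` A" "m + s * m / 2"] ne s m0 unfolding m_def by auto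
  \<comment> \<open>The linear functional whose coefficient vector points from \<open>Y\<close> to
    \<open>P\<close>.\<close>
  define f where "f x = (\<Sum>g\<in>F. (T g P - T g Y) * g x)" for x
  have "(\<integral>x. f x \<partial>Q) + m / 2 \<le> (\<integral>x. f x \<partial>P)" if Q: "Q \<in> A" for Q
  proof -
    have Q': "Q \<in> prob_measures \<Sigma>" and Y': "Y \<in> prob_measures \<Sigma>" using Q Y sub by auto
    have fR: "(\<integral>x. f x \<partial>R) = (\<Sum>g\<in>F. (T g P - T g Y) * T g R)" if "R \<in> prob_measures \<Sigma>" for R
      using int[OF that] unfolding f_def T_def by simp
    define S where "S = mixture s Y Q"
    have S: "S \<in> A" using conv Y Q s unfolding convex_measures_def S_def by auto
    have TS: "T g S = (1 - s) * T g Y + s * T g Q" if "g \<in> F" for g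
      unfolding T_def S_def
      using s int Q' Y' that by (intro integral_mixture) (auto simp: prob_measuresD(2))
    have "m \<le> D S" using mD S by simp
    \<comment> \<open>Expansion of the squared distance along the segment from \<open>Y\<close> to
      \<open>Q\<close>. Near-minimality of \<open>Y\<close> and the quadratic term each cost
      \<open>s * m / 2\<close>; division by \<open>2 * s\<close> leaves \<open>m / 2\<close> as
      bound for the inner product of \<open>P - Y\<close> and \<open>Q - Y\<close>.\<close>
    also have "D S = (\<Sum>g\<in>F. (T g P - T g Y)\<^sup>2 - 2 * s * ((T g P - T g Y) * (T g Q - T g Y)) + s\<^sup>2 * (T g Q - T g Y)\<^sup>2)"
      unfolding D_def by (intro sum.cong) (auto simp: TS power2_eq_square algebra_simps)
    also have "\<dots> = D Y - 2 * s * (\<Sum>g\<in>F. (T g P - T g Y) * (T g Q - T g Y)) + s\<^sup>2 * (\<Sum>g\<in>F. (T g Q - T g Y)\<^sup>2)"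
      unfolding D_def by (simp add: sum.distrib sum_subtractf sum_distrib_left)
    also have "\<dots> \<le> m + s * m / 2 - 2 * s * (\<Sum>g\<in>F. (T g P - T g Y) * (T g Q - T g Y)) + s * (m / 2)"
    proof -
      have "s\<^sup>2 * (\<Sum>g\<in>F. (T g Q - T g Y)\<^sup>2) \<le> s\<^sup>2 * K"
        using K[OF Y(1) Q] by (intro mult_left_mono) auto
      also have "\<dots> \<le> s * (m / 2)"
        using mult_left_mono[OF s(3), of s] s by (simp add: power2_eq_square mult_ac)
      finally show ?thesis using Y(2) by linarith
    qed
    finally have "s * (2 * (\<Sum>g\<in>F. (T g P - T g Y) * (T g Q - T g Y))) \<le> s * m"
      by (simp add: algebra_simps)
    then have 1: "(\<Sum>g\<in>F. (T g P - T g Y) * (T g Q - T g Y)) \<le> m / 2" using s(1) by simp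
    \<comment> \<open>The vector from \<open>Q\<close> to \<open>P\<close> is the one from
      \<open>Y\<close> to \<open>P\<close> minus the one from \<open>Y\<close> to \<open>Q\<close>.
      Its inner product with \<open>P - Y\<close> is therefore at least
      \<open>m - m / 2\<close>.\<close>
    have "(\<integral>x. f x \<partial>P) - (\<integral>x. f x \<partial>Q) = D Y - (\<Sum>g\<in>F. (T g P - T g Y) * (T g Q - T g Y))"
      unfolding fR[OF P(1)] fR[OF Q'] D_def sum_subtractf[symmetric]
      by (intro sum.cong) (auto simp: power2_eq_square algebra_simps)
    then show ?thesis using 1 mD[OF Y(1)] by linarith
  qed
  moreover have "continuous_on \<Sigma> f"
    unfolding f_def using cF by (intro continuous_intros) auto
  moreover have "bounded (f ` \<Sigma>)"
  proof -
    have "\<bar>f x\<bar> \<le> (\<Sum>g\<in>F. \<bar>T g P - T g Y\<bar> * B g)" if "x \<in> \<Sigma>" for x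
      unfolding f_def using B[OF _ that]
      by (intro order.trans[OF sum_abs] sum_mono) (auto simp: abs_mult intro!: mult_left_mono)
    then show ?thesis unfolding bounded_iff by auto
  qed
  ultimately show ?thesis using that[of f "m / 2"] m0 by simp
qed

section \<open>The Donsker--Varadhan formula\<close>

text \<open>The Radon-Nikodym derivative is finite almost everywhere because \<open>N\<close> is
  finite, so its real part still represents \<open>N\<close>. Base \<open>exp 1\<close> turns
  \<open>entropy_density\<close> into a natural logarithm.\<close>

lemma (in prob_space) real_density_of_absolutely_continuous:
  assumes "prob_space N" "absolutely_continuous M N" "sets N = sets M"
    and h_def: "\<And>x. h x = enn2real (RN_deriv M N x)"
  shows "N = density M (\<lambda>x. ennreal (h x))" "entropy_density (exp 1) M N = (\<lambda>x. ln (h x))"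
proof -
  interpret N: prob_space N by fact
  have "N = density M (RN_deriv M N)"
    using density_RN_deriv[OF assms(2,3)] by simp
  also have "\<dots> = density M (\<lambda>x. ennreal (h x))"
    using RN_deriv_finite[OF N.sigma_finite_measure_axioms assms(2,3)]
    by (intro density_cong) (auto simp: h_def less_top)
  finally show "N = density M (\<lambda>x. ennreal (h x))" .
  show "entropy_density (exp 1) M N = (\<lambda>x. ln (h x))"
    by (auto simp: entropy_density_def h_def log_ln)
qed

text \<open>A real bound excludes the infinite branch of \<open>KL\<close>. Integrals against
  \<open>Q\<close> then become integrals against \<open>P\<close> with the weight
  \<open>h\<close>.\<close>

lemma KL_leE:
  assumes "P \<in> prob_measures \<Sigma>" "Q \<in> prob_measures \<Sigma>" "KL Q P \<le> ereal r"
  obtains h where "h \<in> borel_measurable P" "\<And>x. 0 \<le> h x" "Q = density P (\<lambda>x. ennreal (h x))"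
    "integrable P (\<lambda>x. h x * ln (h x))" "(\<integral>x. h x * ln (h x) \<partial>P) \<le> r"
proof -
  interpret P: prob_space P using prob_measuresD(1)[OF assms(1)] .
  have s: "sets Q = sets P" using prob_measuresD(2) assms by metis
  have Q: "prob_space Q" using prob_measuresD(1) assms by blast
  have ac: "absolutely_continuous P Q" and i: "integrable Q (entropy_density (exp 1) P Q)"
    and le: "(\<integral>x. entropy_density (exp 1) P Q x \<partial>Q) \<le> r"
    using assms(3) unfolding KL_def KL_divergence_def by (auto split: if_splits)
  define h where "h x = enn2real (RN_deriv P Q x)" for x
  note h = P.real_density_of_absolutely_continuous[OF Q ac s h_def]
  have m[measurable]: "h \<in> borel_measurable P" unfolding h_def by measurable
  have "integrable P (\<lambda>x. h x * ln (h x))"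
    using i unfolding h(2) by (subst (asm) h(1), subst (asm) integrable_real_density) (auto simp: h_def)
  moreover have "(\<integral>x. h x * ln (h x) \<partial>P) \<le> r"
    using le unfolding h(2) by (subst (asm) h(1), subst (asm) integral_real_density) (auto simp: h_def)
  ultimately show ?thesis using that[OF m _ h(1)] by (simp add: h_def)
qed

text \<open>The easy half of the Donsker--Varadhan variational formula: \<open>f\<close> is compared with the
  maximiser \<open>ln h\<close> through \<open>ln y \<le> y - 1\<close>.\<close>

lemma (in prob_space) Donsker_Varadhan_le:
  assumes [measurable]: "h \<in> borel_measurable M" and h: "\<And>x. 0 \<le> h x"
    and dens: "prob_space (density M (\<lambda>x. ennreal (h x)))"
    and int: "integrable M (\<lambda>x. h x * ln (h x))"
    and f[measurable]: "f \<in> borel_measurable M" and B: "\<And>x. x \<in> space M \<Longrightarrow> \<bar>f x\<bar> \<le> B"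
  shows "(\<integral>x. f x \<partial>density M (\<lambda>x. ennreal (h x))) \<le> ln (\<integral>x. exp (f x) \<partial>M) + (\<integral>x. h x * ln (h x) \<partial>M)"
proof -
  interpret Q: prob_space "density M (\<lambda>x. ennreal (h x))" by fact
  have ih: "integrable M h" and h1: "(\<integral>x. h x \<partial>M) = 1"
  proof -
    have "integrable (density M (\<lambda>x. ennreal (h x))) (\<lambda>x. 1 :: real)" by simp
    then show "integrable M h" using h by (subst (asm) integrable_real_density) auto
    have "(\<integral>x. 1 \<partial>density M (\<lambda>x. ennreal (h x))) = (1::real)"
      using Q.prob_space by simp
    then show "(\<integral>x. h x \<partial>M) = 1" using h by (subst (asm) integral_real_density) auto
  qed
  have ie: "integrable M (\<lambda>x. exp (f x))"
    using B by (intro integrable_const_bound[of _ "exp B"]) (auto simp: abs_le_iff)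
  define Z where "Z = (\<integral>x. exp (f x) \<partial>M)"
  have "exp (- B) \<le> Z"
    unfolding Z_def using B by (intro integral_ge_const ie AE_I2) (metis abs_le_D2 exp_le_cancel_iff minus_le_iff)
  then have Z: "Z > 0" using exp_gt_zero[of "- B"] by linarith
  have iq: "integrable (density M (\<lambda>x. ennreal (h x))) f"
    using B by (intro Q.integrable_const_bound[of _ B]) auto
  then have ihf: "integrable M (\<lambda>x. h x * f x)"
    using h by (subst (asm) integrable_real_density) auto
  \<comment> \<open>The bound on the logarithm is taken at \<open>exp (f x) / (Z * h x)\<close>, the
    ratio of the exponentially tilted density to \<open>h\<close>, and multiplied by
    \<open>h x\<close>. The right-hand side integrates to \<open>1 - 1\<close>. Where
    \<open>h x = 0\<close> the left-hand side vanishes.\<close>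
  have "h x * f x - ln Z * h x - h x * ln (h x) \<le> exp (f x) / Z - h x" for x
  proof (cases "h x = 0")
    case False
    then have hx: "h x > 0" using h[of x] by linarith
    have "ln (exp (f x) / (Z * h x)) \<le> exp (f x) / (Z * h x) - 1"
      using hx Z by (intro ln_le_minus_one) auto
    also have "ln (exp (f x) / (Z * h x)) = f x - ln Z - ln (h x)"
      using hx Z by (simp add: ln_div ln_mult)
    finally have "h x * (f x - ln Z - ln (h x)) \<le> h x * (exp (f x) / (Z * h x) - 1)"
      using hx by (intro mult_left_mono) auto
    also have "h x * (exp (f x) / (Z * h x) - 1) = exp (f x) / Z - h x"
      using hx Z by (simp add: field_simps)
    finally show ?thesis by (simp add: algebra_simps)
  qed (use Z in auto)
  then have "(\<integral>x. h x * f x - ln Z * h x - h x * ln (h x) \<partial>M) \<le> (\<integral>x. exp (f x) / Z - h x \<partial>M)"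
    using ihf ih int ie by (intro integral_mono) auto
  then have "(\<integral>x. h x * f x \<partial>M) - ln Z - (\<integral>x. h x * ln (h x) \<partial>M) \<le> 0"
    using ihf ih int ie h1 Z by (simp add: Z_def[symmetric])
  moreover have "(\<integral>x. f x \<partial>density M (\<lambda>x. ennreal (h x))) = (\<integral>x. h x * f x \<partial>M)"
    using h by (subst integral_real_density) auto
  ultimately show ?thesis by (simp add: Z_def)
qed

text \<open>Large multiples of the indicator of a \<open>P\<close>-null set leave the right-hand
  side at \<open>r\<close> while the left-hand side grows linearly with the \<open>Q\<close>-measure
  of the set.\<close>

lemma absolutely_continuous_if_Donsker_Varadhan:
  fixes r :: real
  assumes "prob_space P" "prob_space Q" and s: "sets Q = sets P"
    and DV: "\<And>f B. f \<in> borel_measurable P \<Longrightarrow> (\<And>x. \<bar>f x\<bar> \<le> B) \<Longrightarrow>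
      (\<integral>x. f x \<partial>Q) \<le> ln (\<integral>x. exp (f x) \<partial>P) + r"
  shows "absolutely_continuous P Q"
  unfolding absolutely_continuous_def
proof
  interpret P: prob_space P by fact
  interpret Q: prob_space Q by fact
  fix A assume A: "A \<in> null_sets P"
  then have [measurable]: "A \<in> sets P" by auto
  have "c * measure Q A \<le> r" if "c \<ge> 0" for c
  proof -
    have "(\<integral>x. c * indicator A x \<partial>Q) \<le> ln (\<integral>x. exp (c * indicator A x) \<partial>P) + r"
      using that by (intro DV[of _ c]) (auto simp: indicator_def)
    moreover have "(\<integral>x. exp (c * indicator A x) \<partial>P) = (\<integral>x. 1 \<partial>P)"
      using AE_not_in[OF A]
      by (intro integral_cong_AE) (auto elim!: eventually_mono simp: indicator_def)
    ultimately show ?thesis using s by (simp add: P.prob_space)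
  qed
  \<comment> \<open>\<open>c = 0\<close> yields \<open>0 \<le> r\<close>, which makes the second
    choice of \<open>c\<close> nonnegative; that choice would give
    \<open>r + 1 \<le> r\<close>.\<close>
  from this[of 0] this[of "(r + 1) / measure Q A"] have "measure Q A = 0"
    by (cases "measure Q A = 0") (auto simp: measure_nonneg)
  then show "A \<in> null_sets Q" using s by (auto simp: null_sets_def Q.emeasure_eq_measure)
qed

text \<open>The sharp constant is -1/e; the cruder -1 comes directly from
  \<open>ln y \<le> y - 1\<close> at \<open>y = 1 / x\<close> and is enough to make shifted
  integrands nonnegative.\<close>

lemma mult_ln_ge_minus_one:
  assumes "0 \<le> (x::real)"
  shows "-1 \<le> x * ln x"
proof (cases "x = 0")
  case False
  then have "x > 0" using assms by simp
  then have "ln (1 / x) \<le> 1 / x - 1" by (intro ln_le_minus_one) auto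
  then have "x * ln (1 / x) \<le> x * (1 / x - 1)" using \<open>x > 0\<close> by (intro mult_left_mono) auto
  then show ?thesis using \<open>x > 0\<close> by (simp add: ln_div right_diff_distrib)
qed simp

text \<open>The hard half of the Donsker--Varadhan formula: the test functions are the truncations of
  \<open>ln h\<close>, and \<open>h ln h \<ge> -1\<close> allows Fatou's lemma.\<close>

lemma KL_le_if_Donsker_Varadhan:
  assumes P: "prob_space P" and Q: "prob_space Q" and s: "sets Q = sets P"
    and DV: "\<And>f B. f \<in> borel_measurable P \<Longrightarrow> (\<And>x. \<bar>f x\<bar> \<le> B) \<Longrightarrow>
      (\<integral>x. f x \<partial>Q) \<le> ln (\<integral>x. exp (f x) \<partial>P) + r"
  shows "KL Q P \<le> ereal r"
proof -
  interpret P: prob_space P by fact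
  interpret Q: prob_space Q by fact
  have ac: "absolutely_continuous P Q"
    using absolutely_continuous_if_Donsker_Varadhan[OF P Q s DV] .
  define h where "h x = enn2real (RN_deriv P Q x)" for x
  note h = P.real_density_of_absolutely_continuous[OF Q ac s h_def]
  have m[measurable]: "h \<in> borel_measurable P" unfolding h_def by measurable
  have h0: "0 \<le> h x" for x by (simp add: h_def)
  have ih: "integrable P h" and h1: "(\<integral>x. h x \<partial>P) = 1"
  proof -
    have "integrable Q (\<lambda>x. 1 :: real)" by simp
    then show "integrable P h"
      using h0 by (subst (asm) h(1), subst (asm) integrable_real_density) (auto)
    have "(\<integral>x. 1 \<partial>Q) = (1::real)" by (simp add: Q.prob_space)
    then show "(\<integral>x. h x \<partial>P) = 1"
      using h0 by (subst (asm) h(1), subst (asm) integral_real_density) (auto simp: h_def)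
  qed
  define N where "N n = real (Suc n)" for n
  have N: "N n \<ge> 1" for n by (simp add: N_def)
  have N1: "1 / N n \<le> N n" for n
    using N[of n] mult_mono[of 1 "N n" 1 "N n"] by (simp add: divide_simps)
  \<comment> \<open>\<open>h\<close> clipped to the interval from \<open>1 / N n\<close> to
    \<open>N n\<close>, so that \<open>ln (g n x)\<close> is a bounded test function.\<close>
  define g where "g n x = max (1 / N n) (min (h x) (N n))" for n x
  have gb: "1 / N n \<le> g n x" "g n x \<le> N n" for n x
    using N1[of n] by (auto simp: g_def)
  have g0: "0 < g n x" for n x
    using gb(1)[of n x] N[of n] by (smt (verit) zero_less_divide_1_iff)
  have [measurable]: "g n \<in> borel_measurable P" for n unfolding g_def by measurable
  have lng: "\<bar>ln (g n x)\<bar> \<le> ln (N n)" for n x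
  proof -
    have "ln (1 / N n) \<le> ln (g n x)" "ln (g n x) \<le> ln (N n)"
      using gb[of n x] g0[of n x] N[of n] by auto
    then show ?thesis using N[of n] by (auto simp: ln_div)
  qed
  have ihg: "integrable P (\<lambda>x. h x * ln (g n x))" for n
  proof (rule Bochner_Integration.integrable_bound[of P "\<lambda>x. h x * ln (N n)"])
    show "AE x in P. norm (h x * ln (g n x)) \<le> norm (h x * ln (N n))"
      using lng[of n] h0 N[of n] by (intro AE_I2) (simp add: abs_mult mult_left_mono)
  qed (use ih in auto)
  \<comment> \<open>For the test function \<open>ln (g n x)\<close> the exponential integral is the
    integral of \<open>g n\<close>. Clipping from below adds at most \<open>1 / N n\<close> to the
    total mass 1 of \<open>h\<close>, and \<open>ln y \<le> y - 1\<close> turns this into the error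
    term.\<close>
  have I: "(\<integral>x. h x * ln (g n x) \<partial>P) \<le> r + 1 / N n" for n
  proof -
    have ig: "integrable P (g n)"
      using gb g0 by (intro P.integrable_const_bound[of _ "N n"]) (auto simp: less_imp_le)
    have "(\<integral>x. h x * ln (g n x) \<partial>P) = (\<integral>x. ln (g n x) \<partial>Q)"
      using h0 by (subst h(1), subst integral_real_density) auto
    also have "\<dots> \<le> ln (\<integral>x. exp (ln (g n x)) \<partial>P) + r"
      using lng by (intro DV[of _ "ln (N n)"]) auto
    also have "(\<integral>x. exp (ln (g n x)) \<partial>P) = (\<integral>x. g n x \<partial>P)" using g0 by simp
    also have "ln (\<integral>x. g n x \<partial>P) \<le> (\<integral>x. g n x \<partial>P) - 1"
    proof (rule ln_le_minus_one)
      have "1 / N n \<le> (\<integral>x. g n x \<partial>P)"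
        using gb by (intro P.integral_ge_const ig) auto
      then show "0 < (\<integral>x. g n x \<partial>P)" using N[of n] by (smt (verit) zero_less_divide_1_iff)
    qed
    also have "(\<integral>x. g n x \<partial>P) \<le> (\<integral>x. h x + 1 / N n \<partial>P)"
    proof (intro integral_mono)
      fix x
      have "min (h x) (N n) \<le> h x" "0 \<le> 1 / N n" using N[of n] by auto
      then show "g n x \<le> h x + 1 / N n" using h0[of x] unfolding g_def by linarith
    qed (use ig ih in auto)
    also have "\<dots> = 1 + 1 / N n" using ih h1 by (simp add: P.prob_space)
    finally show ?thesis by simp
  qed
  \<comment> \<open>A lower bound uniform in \<open>n\<close>. Below the clipping range it rests on
    \<open>ln (N n) \<le> N n\<close>, since \<open>h x * N n\<close> is then less than 1; inside
    the range it is the bound for \<open>x * ln x\<close>; above it the logarithm is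
    nonnegative.\<close>
  have low: "0 \<le> h x * ln (g n x) + 1" for n x
  proof -
    consider "h x < 1 / N n" | "1 / N n \<le> h x" "h x \<le> N n" | "h x > N n" by linarith
    then show ?thesis
    proof cases
      case 1
      from 1 N1[of n] have "g n x = 1 / N n" by (auto simp: g_def)
      then have "h x * ln (g n x) = - (h x * ln (N n))" using N[of n] by (simp add: ln_div)
      moreover have "h x * ln (N n) \<le> 1 / N n * N n"
        using 1 h0[of x] N[of n] ln_bound[of "N n"] by (intro mult_mono) auto
      ultimately show ?thesis using N[of n] by simp
    next
      case 2
      then have "g n x = h x" by (auto simp: g_def)
      then show ?thesis using mult_ln_ge_minus_one[OF h0] by (smt (verit))
    next
      case 3
      then have "g n x = N n" using gb[of n x] by (auto simp: g_def)
      then show ?thesis using N[of n] h0[of x] by simp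
    qed
  qed
  have lim: "(\<lambda>n. h x * ln (g n x)) \<longlonglongrightarrow> h x * ln (h x)" for x
  proof (cases "h x = 0")
    case False
    then have hx: "h x > 0" using h0[of x] by linarith
    have "eventually (\<lambda>n. N n > max (h x) (1 / h x)) sequentially"
    proof -
      obtain k where "max (h x) (1 / h x) < real k" using reals_Archimedean2 by blast
      then show ?thesis by (intro eventually_sequentiallyI[of k]) (auto simp: N_def)
    qed
    then have "eventually (\<lambda>n. g n x = h x) sequentially"
    proof eventually_elim
      case (elim n)
      then have "1 / N n \<le> h x" using hx N[of n] by (simp add: field_simps)
      then show ?case using elim by (simp add: g_def)
    qed
    then have "eventually (\<lambda>n. h x * ln (h x) = h x * ln (g n x)) sequentially"
      by eventually_elim simp
    then show ?thesis by (rule Lim_transform_eventually[OF tendsto_const])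
  qed simp
  have "(\<integral>\<^sup>+x. ennreal (h x * ln (h x) + 1) \<partial>P) = (\<integral>\<^sup>+x. liminf (\<lambda>n. ennreal (h x * ln (g n x) + 1)) \<partial>P)"
  proof (intro nn_integral_cong)
    fix x
    have "(\<lambda>n. ennreal (h x * ln (g n x) + 1)) \<longlonglongrightarrow> ennreal (h x * ln (h x) + 1)"
      by (intro tendsto_ennrealI tendsto_add lim tendsto_const)
    then show "ennreal (h x * ln (h x) + 1) = liminf (\<lambda>n. ennreal (h x * ln (g n x) + 1))"
      by (intro lim_imp_Liminf[symmetric]) auto
  qed
  also have "\<dots> \<le> liminf (\<lambda>n. \<integral>\<^sup>+x. ennreal (h x * ln (g n x) + 1) \<partial>P)"
    by (intro nn_integral_liminf) auto
  also have "\<dots> \<le> liminf (\<lambda>n. ennreal (r + 1 / N n + 1))"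
  proof (intro Liminf_mono always_eventually allI)
    fix n
    have "(\<integral>\<^sup>+x. ennreal (h x * ln (g n x) + 1) \<partial>P) = ennreal (\<integral>x. h x * ln (g n x) + 1 \<partial>P)"
      using ihg low by (intro nn_integral_eq_integral) auto
    also have "\<dots> \<le> ennreal (r + 1 / N n + 1)"
      using I[of n] ihg[of n] by (intro ennreal_leI) (simp add: P.prob_space)
    finally show "(\<integral>\<^sup>+x. ennreal (h x * ln (g n x) + 1) \<partial>P) \<le> ennreal (r + 1 / N n + 1)" .
  qed
  also have "\<dots> = ennreal (r + 0 + 1)"
  proof (intro lim_imp_Liminf tendsto_ennrealI tendsto_add tendsto_const)
    show "(\<lambda>n. 1 / N n) \<longlonglongrightarrow> 0" unfolding N_def using LIMSEQ_inverse_real_of_nat by (simp add: inverse_eq_divide)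
  qed auto
  finally have F: "(\<integral>\<^sup>+x. ennreal (h x * ln (h x) + 1) \<partial>P) \<le> ennreal (r + 1)" by simp
  have nn: "0 \<le> h x * ln (h x) + 1" for x using mult_ln_ge_minus_one[OF h0] by (smt (verit))
  have i1: "integrable P (\<lambda>x. h x * ln (h x) + 1)"
    using F nn by (intro integrableI_nonneg) (auto simp: less_top[symmetric] top_unique)
  have i: "integrable P (\<lambda>x. h x * ln (h x))"
    using Bochner_Integration.integrable_diff[OF i1, of "\<lambda>_. 1"] by simp
  \<comment> \<open>The zero test function shows that \<open>r\<close> is nonnegative, so that
    comparing the \<open>ennreal\<close> images of the two sides is comparing the reals.\<close>
  have r: "0 \<le> r"
    using DV[of "\<lambda>_. 0" 0] by (simp add: P.prob_space)
  have "ennreal (\<integral>x. h x * ln (h x) + 1 \<partial>P) \<le> ennreal (r + 1)"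
    using F nn i1 by (subst nn_integral_eq_integral[symmetric]) auto
  then have "(\<integral>x. h x * ln (h x) + 1 \<partial>P) \<le> r + 1"
    using r by (subst (asm) ennreal_le_iff) auto
  then have le: "(\<integral>x. h x * ln (h x) \<partial>P) \<le> r" using i by (simp add: P.prob_space)
  have "integrable Q (entropy_density (exp 1) P Q)"
    using i h0 unfolding h(2) by (subst h(1), subst integrable_real_density) auto
  moreover have "KL_divergence (exp 1) P Q \<le> r"
    using le h0 unfolding KL_divergence_def h(2) by (subst h(1), subst integral_real_density) auto
  ultimately show ?thesis using ac by (simp add: KL_def)
qed

section \<open>Lower semicontinuity of the divergence\<close>

text \<open>Inner regularity replaces a measurable set by a compact subset \<open>K\<close>, and the
  indicator of \<open>K\<close> is the limit of Lipschitz functions of the distance to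
  \<open>K\<close>. Sums and dominated limits preserve approximability.\<close>

lemma lipschitz_L1_dense:
  fixes f :: "'a::{second_countable_topology, complete_space} \<Rightarrow> real"
  assumes "finite_measure M" and sM: "sets M = sets borel" and "integrable M f" "e > 0"
  shows "\<exists>g L. L-lipschitz_on UNIV g \<and> integrable M g \<and> (\<integral>x. \<bar>f x - g x\<bar> \<partial>M) < e"
  using assms(3,4)
proof (induction arbitrary: e rule: integrable_induct)
  case (base A c)
  interpret finite_measure M by fact
  note [measurable_cong] = sM
  have A[measurable]: "A \<in> sets M" by fact
  \<comment> \<open>Losing mass \<open>d\<close> costs at most \<open>e / 2\<close> in L1; the
    summand 1 in the denominator covers \<open>c = 0\<close>.\<close>
  define d where "d = e / (2 * (\<bar>c\<bar> + 1))"
  have d: "d > 0" "\<bar>c\<bar> * d \<le> e / 2"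
    using \<open>e > 0\<close> by (auto simp: d_def divide_simps mult_right_mono)
  have "emeasure M A = (SUP K\<in>{K. K \<subseteq> A \<and> compact K}. emeasure M K)"
    using A sM by (intro inner_regular) auto
  moreover have "\<exists>K. K \<subseteq> A \<and> compact K \<and> measure M A < measure M K + d"
  proof (rule ccontr)
    assume "\<not> ?thesis"
    then have *: "measure M K \<le> measure M A - d" if "K \<subseteq> A" "compact K" for K
      using that by (meson le_diff_eq linorder_not_less)
    have "(SUP K\<in>{K. K \<subseteq> A \<and> compact K}. emeasure M K) \<le> ennreal (measure M A - d)"
      using * by (intro SUP_least) (auto simp: emeasure_eq_measure intro!: ennreal_leI)
    moreover have "0 \<le> measure M A - d" using *[of "{}"] by simp
    moreover have "ennreal (measure M A) = (SUP K\<in>{K. K \<subseteq> A \<and> compact K}. emeasure M K)"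
      using \<open>emeasure M A = _\<close> by (simp add: emeasure_eq_measure)
    ultimately have "measure M A \<le> measure M A - d"
      using ennreal_le_iff by metis
    then show False using d by simp
  qed
  then obtain K where K: "K \<subseteq> A" "compact K" "measure M A < measure M K + d" by blast
  have Ks[measurable]: "K \<in> sets M" using K sM by (simp add: borel_compact)
  \<comment> \<open>The empty set is treated apart because \<open>infdist\<close> to it is 0 by
    convention: the functions below would then be constantly \<open>c\<close> instead of
    approximating 0.\<close>
  show ?case
  proof (cases "K = {}")
    case True
    have "(\<integral>x. \<bar>indicator A x *\<^sub>R c - 0\<bar> \<partial>M) = \<bar>c\<bar> * measure M A"
      by (simp add: abs_mult)
    also have "\<dots> \<le> \<bar>c\<bar> * d" using K True by (intro mult_left_mono) auto
    also have "\<dots> < e" using d \<open>e > 0\<close> by linarith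
    finally show ?thesis
      by (intro exI[of _ "\<lambda>_. 0"] exI[of _ 0]) (auto intro: lipschitz_on_constant)
  next
    case False
    \<comment> \<open>A ramp that equals \<open>c\<close> on \<open>K\<close> and vanishes at
      distance \<open>1 / n\<close> from it; its Lipschitz constant \<open>\<bar>c\<bar> * n\<close>
      may grow, only its existence matters.\<close>
    define g where "g n x = c * max 0 (1 - real n * infdist x K)" for n x
    have g_le: "\<bar>g n x\<bar> \<le> \<bar>c\<bar>" for n x
      unfolding g_def abs_mult by (intro mult_left_le) (auto simp: infdist_nonneg)
    have lip: "(\<bar>c\<bar> * n)-lipschitz_on UNIV (g n)" for n
    proof (rule lipschitz_onI)
      fix x y
      have "\<bar>max 0 (1 - real n * infdist x K) - max 0 (1 - real n * infdist y K)\<bar>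
          \<le> \<bar>real n * infdist x K - real n * infdist y K\<bar>" by linarith
      also have "\<dots> = real n * \<bar>infdist x K - infdist y K\<bar>"
        by (simp add: abs_mult right_diff_distrib[symmetric])
      also have "\<dots> \<le> real n * dist x y"
        by (intro mult_left_mono infdist_triangle_abs) auto
      finally have "\<bar>c\<bar> * \<bar>max 0 (1 - real n * infdist x K) - max 0 (1 - real n * infdist y K)\<bar>
          \<le> \<bar>c\<bar> * (real n * dist x y)" by (rule mult_left_mono) auto
      then show "dist (g n x) (g n y) \<le> \<bar>c\<bar> * real n * dist x y"
        by (simp add: g_def dist_real_def right_diff_distrib[symmetric] abs_mult mult_ac)
    qed auto
    have [measurable]: "g n \<in> borel_measurable M" for n
      using borel_measurable_continuous_onI[OF lipschitz_on_continuous_on[OF lip]] sM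
      by (simp cong: measurable_cong_sets)
    have ig: "integrable M (g n)" for n
      using g_le by (intro integrable_const_bound[of _ "\<bar>c\<bar>"]) auto
    have "(\<lambda>n. g n x) \<longlonglongrightarrow> c * indicator K x" for x
    proof (cases "x \<in> K")
      case True
      then show ?thesis by (simp add: g_def)
    next
      case xK: False
      have pos: "infdist x K > 0"
        using xK K(2) False by (metis compact_imp_closed in_closed_iff_infdist_zero infdist_nonneg less_eq_real_def)
      obtain k where k: "1 / infdist x K < real k" using reals_Archimedean2 by blast
      have "g n x = 0" if "n \<ge> k" for n
      proof -
        have "1 / infdist x K < real n" using k that by linarith
        then have "1 < real n * infdist x K" using pos by (simp add: divide_simps mult.commute)
        then show ?thesis by (simp add: g_def)
      qed
      then show ?thesis
        using xK by (intro tendsto_eventually eventually_sequentiallyI[of k]) auto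
    qed
    then have "(\<lambda>n. \<bar>c * indicator K x - g n x\<bar>) \<longlonglongrightarrow> \<bar>c * indicator K x - c * indicator K x\<bar>" for x
      by (intro tendsto_rabs tendsto_diff tendsto_const)
    then have "(\<lambda>n. \<integral>x. \<bar>c * indicator K x - g n x\<bar> \<partial>M) \<longlonglongrightarrow> (\<integral>x. 0 \<partial>M)"
    proof (intro integral_dominated_convergence[where w = "\<lambda>_. 2 * \<bar>c\<bar>"] AE_I2)
      fix n x
      have "\<bar>c * indicator K x\<bar> \<le> \<bar>c\<bar>" by (auto simp: indicator_def)
      then show "norm \<bar>c * indicator K x - g n x\<bar> \<le> 2 * \<bar>c\<bar>" using g_le[of n x] by auto
    qed auto
    then have "eventually (\<lambda>n. (\<integral>x. \<bar>c * indicator K x - g n x\<bar> \<partial>M) < e / 2) sequentially"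
      using \<open>e > 0\<close> by (intro order_tendstoD) auto
    then obtain n where n: "(\<integral>x. \<bar>c * indicator K x - g n x\<bar> \<partial>M) < e / 2"
      by (auto simp: eventually_sequentially)
    have iA: "integrable M (\<lambda>x. c * indicator A x)" "integrable M (\<lambda>x. c * indicator K x)"
      by (auto simp: emeasure_eq_measure intro!: integrable_mult_right integrable_real_indicator)
    have iD: "integrable M (\<lambda>x. \<bar>c\<bar> * indicator (A - K) x)"
      by (auto simp: emeasure_eq_measure intro!: integrable_mult_right integrable_real_indicator)
    have ic: "integrable M (\<lambda>x. \<bar>c * indicator K x - g n x\<bar>)"
      using iA ig[of n] by auto
    have "(\<integral>x. \<bar>indicator A x *\<^sub>R c - g n x\<bar> \<partial>M) \<le>
        (\<integral>x. \<bar>c\<bar> * indicator (A - K) x + \<bar>c * indicator K x - g n x\<bar> \<partial>M)"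
    proof (intro integral_mono)
      show "integrable M (\<lambda>x. \<bar>indicator A x *\<^sub>R c - g n x\<bar>)"
        using iA(1) ig[of n] by (auto simp: mult.commute)
      show "integrable M (\<lambda>x. \<bar>c\<bar> * indicator (A - K) x + \<bar>c * indicator K x - g n x\<bar>)"
        using iD ic by (rule Bochner_Integration.integrable_add)
      show "\<bar>indicator A x *\<^sub>R c - g n x\<bar> \<le> \<bar>c\<bar> * indicator (A - K) x + \<bar>c * indicator K x - g n x\<bar>" for x
        using K(1) by (cases "x \<in> K"; cases "x \<in> A") auto
    qed
    also have "\<dots> = \<bar>c\<bar> * measure M (A - K) + (\<integral>x. \<bar>c * indicator K x - g n x\<bar> \<partial>M)"
      using iD ic by (subst Bochner_Integration.integral_add) auto
    also have "measure M (A - K) = measure M A - measure M K"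
      using K(1) A Ks by (intro finite_measure_Diff) auto
    also have "\<bar>c\<bar> * (measure M A - measure M K) \<le> e / 2"
      using K(3) d by (intro order.trans[OF mult_left_mono d(2)]) auto
    finally have "(\<integral>x. \<bar>indicator A x *\<^sub>R c - g n x\<bar> \<partial>M) < e" using n by simp
    then show ?thesis using lip ig by blast
  qed
next
  case (add f1 f2)
  have e: "e / 2 > 0" using \<open>e > 0\<close> by simp
  obtain g1 L1 where 1: "L1-lipschitz_on UNIV g1" "integrable M g1" "(\<integral>x. \<bar>f1 x - g1 x\<bar> \<partial>M) < e / 2"
    using add.IH(1)[OF e] by blast
  obtain g2 L2 where 2: "L2-lipschitz_on UNIV g2" "integrable M g2" "(\<integral>x. \<bar>f2 x - g2 x\<bar> \<partial>M) < e / 2"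
    using add.IH(2)[OF e] by blast
  have "(\<integral>x. \<bar>f1 x + f2 x - (g1 x + g2 x)\<bar> \<partial>M) \<le> (\<integral>x. \<bar>f1 x - g1 x\<bar> + \<bar>f2 x - g2 x\<bar> \<partial>M)"
    using 1 2 add.hyps by (intro integral_mono) auto
  also have "\<dots> < e"
    using 1 2 add.hyps by (subst Bochner_Integration.integral_add) auto
  finally show ?case
    using 1 2 lipschitz_on_add[OF 1(1) 2(1)]
    by (intro exI[of _ "\<lambda>x. g1 x + g2 x"] exI[of _ "L1 + L2"]) auto
next
  case (lim f s)
  have [measurable]: "f \<in> borel_measurable M" "s i \<in> borel_measurable M" for i
    using lim.hyps by auto
  \<comment> \<open>The approximating functions in this induction rule satisfy
    \<open>\<bar>s i x\<bar> \<le> 2 * \<bar>f x\<bar>\<close>, whence the dominating function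
    \<open>3 * \<bar>f x\<bar>\<close>.\<close>
  have "(\<lambda>i. \<integral>x. \<bar>f x - s i x\<bar> \<partial>M) \<longlonglongrightarrow> (\<integral>x. 0 \<partial>M)"
  proof (intro integral_dominated_convergence[where w = "\<lambda>x. 3 * \<bar>f x\<bar>"] AE_I2)
    fix x assume x: "x \<in> space M"
    have "(\<lambda>i. \<bar>f x - s i x\<bar>) \<longlonglongrightarrow> \<bar>f x - f x\<bar>"
      using lim.hyps(2)[OF x] by (intro tendsto_rabs tendsto_diff tendsto_const)
    then show "(\<lambda>i. \<bar>f x - s i x\<bar>) \<longlonglongrightarrow> 0" by simp
    show "norm \<bar>f x - s i x\<bar> \<le> 3 * \<bar>f x\<bar>" for i
      using lim.hyps(3)[OF x, of i] by auto
  qed (use lim.hyps in auto)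
  then have "eventually (\<lambda>i. (\<integral>x. \<bar>f x - s i x\<bar> \<partial>M) < e / 2) sequentially"
    using \<open>e > 0\<close> by (intro order_tendstoD) auto
  then obtain i where i: "(\<integral>x. \<bar>f x - s i x\<bar> \<partial>M) < e / 2"
    by (auto simp: eventually_sequentially)
  obtain g L where g: "L-lipschitz_on UNIV g" "integrable M g" "(\<integral>x. \<bar>s i x - g x\<bar> \<partial>M) < e / 2"
    using lim.IH[of "e / 2" i] \<open>e > 0\<close> by auto
  have "(\<integral>x. \<bar>f x - g x\<bar> \<partial>M) \<le> (\<integral>x. \<bar>f x - s i x\<bar> + \<bar>s i x - g x\<bar> \<partial>M)"
    using g lim.hyps by (intro integral_mono) auto
  also have "\<dots> < e"
    using g i lim.hyps by (subst Bochner_Integration.integral_add) auto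
  finally show ?case using g by blast
qed

text \<open>One function has to serve both measures. Each of \<open>P\<close> and \<open>Q\<close>
  is at most twice their average \<open>R\<close>, so an L1 error below \<open>e / 2\<close> for
  \<open>R\<close> is an error below \<open>e\<close> for each.\<close>

lemma lipschitz_L1_approx_pair:
  fixes f :: "'a::euclidean_space \<Rightarrow> real"
  assumes \<Sigma>: "\<Sigma> \<in> sets borel" and P: "P \<in> prob_measures \<Sigma>" and Q: "Q \<in> prob_measures \<Sigma>"
    and f: "f \<in> borel_measurable P" and B: "\<And>x. x \<in> \<Sigma> \<Longrightarrow> \<bar>f x\<bar> \<le> B" and e: "e > 0"
  obtains g L where "L-lipschitz_on UNIV g" "\<And>x. \<bar>g x\<bar> \<le> B"
    "(\<integral>x. \<bar>f x - g x\<bar> \<partial>P) < e" "(\<integral>x. \<bar>f x - g x\<bar> \<partial>Q) < e"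
proof -
  define R where "R = mixture (1 / 2) P Q"
  have R: "R \<in> prob_measures \<Sigma>" unfolding R_def using P Q by (intro mixture_in_prob_measures) auto
  interpret R: prob_space R using prob_measuresD(1)[OF R] .
  have sQ: "sets Q = sets P" and sR: "sets R = sets P" using P Q R by (auto simp: prob_measuresD(2))
  have sp: "space P = \<Sigma>" "space Q = \<Sigma>" "space R = \<Sigma>" using P Q R by (auto simp: prob_measuresD(3))
  have id[measurable]: "(\<lambda>x. x) \<in> measurable R borel"
    using prob_measuresD(2)[OF R] by (simp add: measurable_restrict_space1 cong: measurable_cong_sets)
  \<comment> \<open>\<open>R\<close> is pushed from \<open>\<Sigma>\<close> to the whole space,
    where the density of Lipschitz functions is available; \<open>f\<close> is extended by 0
    accordingly.\<close>
  define M where "M = distr R borel (\<lambda>x. x)"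
  interpret M: prob_space M unfolding M_def by (rule R.prob_space_distr) measurable
  have B0: "B \<ge> 0"
    using B R.not_empty sp by fastforce
  define f0 where "f0 x = (if x \<in> \<Sigma> then f x else 0)" for x
  have f0[measurable]: "f0 \<in> borel_measurable borel"
    using f prob_measuresD(2)[OF P] \<Sigma> unfolding f0_def
    by (simp add: borel_measurable_restrict_space_iff[symmetric] measurable_restrict_space_iff[symmetric] cong: measurable_cong_sets)
  have i0: "integrable M f0"
    using B B0 by (intro M.integrable_const_bound[of _ B]) (auto simp: f0_def M_def)
  obtain g L where g: "L-lipschitz_on UNIV g" "integrable M g" "(\<integral>x. \<bar>f0 x - g x\<bar> \<partial>M) < e / 2"
    using lipschitz_L1_dense[OF M.finite_measure_axioms _ i0, of "e / 2"] e by (auto simp: M_def)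
  have gm[measurable]: "g \<in> borel_measurable borel" using g(2) by (auto simp: M_def)
  \<comment> \<open>Clipping to the range of \<open>f\<close> does not increase the Lipschitz
    constant and brings the values no farther from those of \<open>f0\<close>.\<close>
  define k where "k x = max (- B) (min B (g x))" for x
  have kB: "\<bar>k x\<bar> \<le> B" for x using B0 by (auto simp: k_def)
  have klip: "L-lipschitz_on UNIV k"
  proof (rule lipschitz_onI)
    fix x y
    have "dist (k x) (k y) \<le> dist (g x) (g y)" unfolding k_def dist_real_def by linarith
    then show "dist (k x) (k y) \<le> L * dist x y"
      using lipschitz_onD[OF g(1), of x y] by simp
  qed (use lipschitz_on_nonneg[OF g(1)] in simp)
  have km[measurable]: "k \<in> borel_measurable borel" unfolding k_def by measurable
  have mP: "(\<lambda>x. \<bar>f x - k x\<bar>) \<in> borel_measurable P"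
    using f km id sR by (intro borel_measurable_abs borel_measurable_diff) (auto intro: measurable_compose cong: measurable_cong_sets)
  have iPQ: "integrable S (\<lambda>x. \<bar>f x - k x\<bar>)" if "S \<in> prob_measures \<Sigma>" for S
  proof (rule integrable_bounded_prob_measures[OF that])
    show "(\<lambda>x. \<bar>f x - k x\<bar>) \<in> borel_measurable S"
      using mP that P by (simp add: prob_measuresD(2) cong: measurable_cong_sets)
    have "\<bar>f x - k x\<bar> \<le> 2 * B" if "x \<in> \<Sigma>" for x
      using B[OF that] kB[of x] by linarith
    then show "bounded ((\<lambda>x. \<bar>f x - k x\<bar>) ` \<Sigma>)" unfolding bounded_iff by auto
  qed
  have "(\<integral>x. \<bar>f x - k x\<bar> \<partial>R) = (\<integral>x. \<bar>f0 x - k x\<bar> \<partial>R)"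
    using sp by (intro Bochner_Integration.integral_cong) (auto simp: f0_def)
  also have "\<dots> = (\<integral>x. \<bar>f0 x - k x\<bar> \<partial>M)"
    unfolding M_def by (intro integral_distr[symmetric]) auto
  also have "\<dots> \<le> (\<integral>x. \<bar>f0 x - g x\<bar> \<partial>M)"
  proof (intro integral_mono)
    show "integrable M (\<lambda>x. \<bar>f0 x - k x\<bar>)"
      using i0 kB by (intro integrable_abs Bochner_Integration.integrable_diff M.integrable_const_bound[of k B]) (auto simp: M_def)
    show "\<bar>f0 x - k x\<bar> \<le> \<bar>f0 x - g x\<bar>" for x
    proof -
      have "\<bar>f0 x\<bar> \<le> B" using B B0 by (auto simp: f0_def)
      then show ?thesis unfolding k_def by linarith
    qed
  qed (use i0 g in auto)
  finally have "(\<integral>x. \<bar>f x - k x\<bar> \<partial>R) < e / 2" using g by simp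
  moreover have "(\<integral>x. \<bar>f x - k x\<bar> \<partial>R) = (1 - 1 / 2) * (\<integral>x. \<bar>f x - k x\<bar> \<partial>P) + 1 / 2 * (\<integral>x. \<bar>f x - k x\<bar> \<partial>Q)"
    unfolding R_def using iPQ P Q by (intro integral_mixture sQ) auto
  moreover have "0 \<le> (\<integral>x. \<bar>f x - k x\<bar> \<partial>P)" "0 \<le> (\<integral>x. \<bar>f x - k x\<bar> \<partial>Q)" by auto
  moreover have "a < e \<and> b < e" if "c < e / 2" "c = (1 - 1 / 2) * a + 1 / 2 * b" "0 \<le> a" "0 \<le> b" for a b c :: real
    using that by (auto simp: field_simps)
  ultimately have "(\<integral>x. \<bar>f x - k x\<bar> \<partial>P) < e \<and> (\<integral>x. \<bar>f x - k x\<bar> \<partial>Q) < e" by blast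
  then show ?thesis using that[OF klip kB] by blast
qed

text \<open>A one-sided Lipschitz bound for \<open>exp\<close> below \<open>B\<close>, from the
  tangent at \<open>y\<close>. It bounds the exponential integral of an approximant by that of the
  original plus an L1 error.\<close>

lemma exp_diff_le:
  assumes "(x::real) \<le> B" "y \<le> B"
  shows "exp y - exp x \<le> exp B * \<bar>x - y\<bar>"
proof (cases "x \<le> y")
  case True
  have "exp y * (1 + (x - y)) \<le> exp y * exp (x - y)"
    using exp_ge_add_one_self[of "x - y"] by (intro mult_left_mono) auto
  then have "exp y - exp x \<le> exp y * (y - x)" by (simp add: exp_diff algebra_simps)
  also have "\<dots> \<le> exp B * (y - x)" using assms True by (intro mult_right_mono) auto
  finally show ?thesis using True by simp
next
  case False
  then have "exp y - exp x \<le> 0" by simp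
  also have "0 \<le> exp B * \<bar>x - y\<bar>" by simp
  finally show ?thesis .
qed

text \<open>Replacing \<open>f\<close> by a Lipschitz function within L1 distance \<open>d\<close>
  moves the left-hand side by at most \<open>d\<close> and raises the logarithm by at most
  \<open>exp B * d / Z\<close>.\<close>

lemma Donsker_Varadhan_from_lipschitz:
  fixes P Q :: "'a::euclidean_space measure" and r :: real
  assumes \<Sigma>: "\<Sigma> \<in> sets borel" and P: "P \<in> prob_measures \<Sigma>" and Q: "Q \<in> prob_measures \<Sigma>"
    and DV: "\<And>f L B. L-lipschitz_on UNIV f \<Longrightarrow> (\<And>x. \<bar>f x\<bar> \<le> B) \<Longrightarrow>
      (\<integral>x. f x \<partial>Q) \<le> ln (\<integral>x. exp (f x) \<partial>P) + r"
    and f: "f \<in> borel_measurable P" and B: "\<And>x. x \<in> \<Sigma> \<Longrightarrow> \<bar>f x\<bar> \<le> B"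
  shows "(\<integral>x. f x \<partial>Q) \<le> ln (\<integral>x. exp (f x) \<partial>P) + r"
proof (rule field_le_epsilon)
  fix e :: real assume e: "e > 0"
  interpret P: prob_space P using prob_measuresD(1)[OF P] .
  interpret Q: prob_space Q using prob_measuresD(1)[OF Q] .
  have sp: "space P = \<Sigma>" "space Q = \<Sigma>" using P Q by (auto simp: prob_measuresD(3))
  have int: "integrable S u" if "S \<in> prob_measures \<Sigma>" "u \<in> borel_measurable P" "\<And>x. x \<in> \<Sigma> \<Longrightarrow> \<bar>u x\<bar> \<le> C"
    for S C and u :: "'a \<Rightarrow> real"
  proof (rule integrable_bounded_prob_measures[OF that(1)])
    show "u \<in> borel_measurable S"
      using that(1,2) P by (simp add: prob_measuresD(2) cong: measurable_cong_sets)
    show "bounded (u ` \<Sigma>)" using that(3) unfolding bounded_iff by auto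
  qed
  define Z where "Z = (\<integral>x. exp (f x) \<partial>P)"
  have ief: "integrable P (\<lambda>x. exp (f x))"
    using f B by (intro int[OF P, of _ "exp B"]) (auto simp: abs_le_iff)
  have "exp (- B) \<le> Z"
    unfolding Z_def using B sp by (intro P.integral_ge_const ief AE_I2) (metis abs_le_D2 exp_le_cancel_iff minus_le_iff)
  then have Z: "Z > 0" using exp_gt_zero[of "- B"] by linarith
  \<comment> \<open>Chosen so that the two errors, \<open>d\<close> on the left and
    \<open>exp B * d / Z\<close> in the logarithm, add up to \<open>e\<close>.\<close>
  define d where "d = e / (1 + exp B / Z)"
  have cf: "1 + exp B / Z > 0" using Z by (simp add: add_pos_pos)
  have d: "d > 0" "d * (1 + exp B / Z) = e"
    using e cf by (auto simp: d_def)
  obtain g L where g: "L-lipschitz_on UNIV g" "\<And>x. \<bar>g x\<bar> \<le> B"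
    "(\<integral>x. \<bar>f x - g x\<bar> \<partial>P) < d" "(\<integral>x. \<bar>f x - g x\<bar> \<partial>Q) < d"
    using lipschitz_L1_approx_pair[OF \<Sigma> P Q f B d(1)] by blast
  have gm: "g \<in> borel_measurable P"
    using continuous_on_measurable_prob_measures[OF P] lipschitz_on_continuous_on[OF g(1)]
      continuous_on_subset by blast
  have fQ: "integrable Q f" and gQ: "integrable Q g" and fgP: "integrable P (\<lambda>x. \<bar>f x - g x\<bar>)"
    and fgQ: "integrable Q (\<lambda>x. \<bar>f x - g x\<bar>)"
    using int[OF Q f, of B] int[OF Q gm, of B] int[OF P f, of B] int[OF P gm, of B] B g(2) by auto
  have ieg: "integrable P (\<lambda>x. exp (g x))"
    using gm g(2) by (intro int[OF P, of _ "exp B"]) (auto simp: abs_le_iff)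
  have "exp (- B) \<le> (\<integral>x. exp (g x) \<partial>P)"
    using g(2) by (intro P.integral_ge_const ieg AE_I2) (metis abs_le_D2 exp_le_cancel_iff minus_le_iff)
  then have Zg: "(\<integral>x. exp (g x) \<partial>P) > 0" using exp_gt_zero[of "- B"] by linarith
  have "(\<integral>x. exp (g x) \<partial>P) \<le> (\<integral>x. exp (f x) + exp B * \<bar>f x - g x\<bar> \<partial>P)"
  proof (intro integral_mono)
    fix x assume "x \<in> space P"
    then have "f x \<le> B" "g x \<le> B" using B[of x] g(2)[of x] sp by auto
    then show "exp (g x) \<le> exp (f x) + exp B * \<bar>f x - g x\<bar>"
      using exp_diff_le by (smt (verit))
  qed (use ief ieg fgP in auto)
  also have "\<dots> = Z + exp B * (\<integral>x. \<bar>f x - g x\<bar> \<partial>P)"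
    using ief fgP by (simp add: Z_def)
  also have "\<dots> \<le> Z + exp B * d" using g(3) by (intro add_left_mono mult_left_mono) auto
  also have "\<dots> = Z * (1 + exp B * d / Z)" using Z by (simp add: distrib_left)
  finally have "ln (\<integral>x. exp (g x) \<partial>P) \<le> ln (Z * (1 + exp B * d / Z))"
    using Zg by (subst ln_le_cancel_iff) auto
  also have "\<dots> = ln Z + ln (1 + exp B * d / Z)"
    using Z d by (intro ln_mult_pos) (auto intro: add_pos_nonneg)
  also have "ln (1 + exp B * d / Z) \<le> exp B * d / Z"
    using Z d by (intro ln_add_one_self_le_self) auto
  finally have 1: "ln (\<integral>x. exp (g x) \<partial>P) \<le> ln Z + exp B * d / Z" by simp
  have "(\<integral>x. f x \<partial>Q) \<le> (\<integral>x. g x + \<bar>f x - g x\<bar> \<partial>Q)"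
    using fQ gQ fgQ by (intro integral_mono) auto
  also have "\<dots> \<le> (\<integral>x. g x \<partial>Q) + d" using gQ fgQ g(4) by simp
  also have "(\<integral>x. g x \<partial>Q) \<le> ln (\<integral>x. exp (g x) \<partial>P) + r" by (rule DV[OF g(1,2)])
  finally have "(\<integral>x. f x \<partial>Q) \<le> ln Z + r + d * (1 + exp B / Z)"
    using 1 by (simp add: distrib_left mult_ac)
  then show "(\<integral>x. f x \<partial>Q) \<le> ln (\<integral>x. exp (f x) \<partial>P) + r + e"
    using d(2) by (simp add: Z_def)
qed

section \<open>Integrals of Lipschitz functions under the two distances\<close>

text \<open>The cut at \<open>B\<close> confines the levels to a bounded interval, so that an
  additive error in the measure of each level set contributes at most \<open>B\<close> times that
  error.\<close>

lemma layer_cake: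
  fixes u :: "'a \<Rightarrow> real"
  assumes "sigma_finite_measure M" and u[measurable]: "u \<in> borel_measurable M"
    and u0: "\<And>x. 0 \<le> u x" and B: "0 \<le> B"
  shows "(\<integral>\<^sup>+x. ennreal (min (u x) B) \<partial>M) = (\<integral>\<^sup>+t\<in>{0..B}. emeasure M {x \<in> space M. t < u x} \<partial>lborel)"
proof -
  interpret pair_sigma_finite M lborel
    using assms(1) by (simp add: pair_sigma_finite_def sigma_finite_lborel)
  have "(\<integral>\<^sup>+x. ennreal (min (u x) B) \<partial>M) =
      (\<integral>\<^sup>+x. (\<integral>\<^sup>+t. indicator {t. 0 \<le> t \<and> t \<le> B \<and> t < u x} t \<partial>lborel) \<partial>M)"
  proof (intro nn_integral_cong)
    fix x
    have "ennreal (min (u x) B) = emeasure lborel {0<..<min (u x) B}"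
      using u0[of x] B by simp
    also have "\<dots> = (\<integral>\<^sup>+t. indicator {0<..<min (u x) B} t \<partial>lborel)" by simp
    \<comment> \<open>The two intervals of levels can differ only in the points 0 and
      \<open>B\<close>, which are null.\<close>
    also have "\<dots> = (\<integral>\<^sup>+t. indicator {t. 0 \<le> t \<and> t \<le> B \<and> t < u x} t \<partial>lborel)"
    proof (intro nn_integral_cong_AE)
      have "AE t in lborel. t \<noteq> 0 \<and> t \<noteq> B"
        using AE_lborel_singleton[of 0] AE_lborel_singleton[of B] by eventually_elim simp
      then show "AE t in lborel. (indicator {0<..<min (u x) B} t :: ennreal) =
          indicator {t. 0 \<le> t \<and> t \<le> B \<and> t < u x} t"
        by eventually_elim (auto simp: indicator_def)
    qed
    finally show "ennreal (min (u x) B) = (\<integral>\<^sup>+t. indicator {t. 0 \<le> t \<and> t \<le> B \<and> t < u x} t \<partial>lborel)" .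
  qed
  also have "\<dots> = (\<integral>\<^sup>+t. (\<integral>\<^sup>+x. indicator {t. 0 \<le> t \<and> t \<le> B \<and> t < u x} t \<partial>M) \<partial>lborel)"
    by (intro Fubini'[symmetric]) measurable
  also have "\<dots> = (\<integral>\<^sup>+t\<in>{0..B}. emeasure M {x \<in> space M. t < u x} \<partial>lborel)"
  proof (intro nn_integral_cong)
    fix t
    have "(\<integral>\<^sup>+x. indicator {t. 0 \<le> t \<and> t \<le> B \<and> t < u x} t \<partial>M) =
        (\<integral>\<^sup>+x. indicator {0..B} t * indicator {x \<in> space M. t < u x} x \<partial>M)"
      by (intro nn_integral_cong) (auto simp: indicator_def)
    also have "\<dots> = emeasure M {x \<in> space M. t < u x} * indicator {0..B} t"
      by (subst nn_integral_cmult) (auto simp: mult.commute)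
    finally show "(\<integral>\<^sup>+x. indicator {t. 0 \<le> t \<and> t \<le> B \<and> t < u x} t \<partial>M) =
      emeasure M {x \<in> space M. t < u x} * indicator {0..B} t" .
  qed
  finally show ?thesis .
qed

lemma lipschitz_integrable_prob_measures:
  fixes f :: "'a::euclidean_space \<Rightarrow> real"
  assumes "P \<in> prob_measures \<Sigma>" "L-lipschitz_on UNIV f" "\<And>x. \<bar>f x\<bar> \<le> B"
  shows "integrable P f"
proof (rule integrable_continuous_prob_measures[OF assms(1)])
  show "continuous_on \<Sigma> f"
    using lipschitz_on_continuous_on[OF assms(2)] continuous_on_subset by blast
  show "bounded (f ` \<Sigma>)" using assms(3) unfolding bounded_iff by auto
qed

text \<open>The easy direction of Kantorovich-Rubinstein duality: the Lipschitz inequality is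
  integrated over a coupling. The strict bound on the infimum provides one of cost below
  \<open>e\<close>, so no optimal coupling has to exist.\<close>

lemma wasserstein_lipschitz:
  fixes f :: "'a::euclidean_space \<Rightarrow> real"
  assumes P: "P \<in> prob_measures \<Sigma>" and Q: "Q \<in> prob_measures \<Sigma>"
    and lip: "L-lipschitz_on UNIV f" and B: "\<And>x. \<bar>f x\<bar> \<le> B"
    and W: "wasserstein \<Sigma> P Q < ennreal e"
  shows "(\<integral>x. f x \<partial>P) \<le> (\<integral>x. f x \<partial>Q) + L * e"
proof -
  obtain \<gamma> where g: "\<gamma> \<in> couplings \<Sigma> P Q" and I: "(\<integral>\<^sup>+(\<xi>', \<xi>). ennreal (norm (\<xi>' - \<xi>)) \<partial>\<gamma>) < ennreal e"
    using W unfolding wasserstein_def INF_less_iff by blast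
  have s[measurable_cong]: "sets \<gamma> = sets (borel_on \<Sigma> \<Otimes>\<^sub>M borel_on \<Sigma>)"
    and dP: "distr \<gamma> (borel_on \<Sigma>) fst = P" and dQ: "distr \<gamma> (borel_on \<Sigma>) snd = Q"
    using g by (auto simp: couplings_def)
  have L: "L \<ge> 0" using lipschitz_on_nonneg[OF lip] .
  have fm[measurable]: "f \<in> borel_measurable borel"
    using borel_measurable_continuous_onI[OF lipschitz_on_continuous_on[OF lip]] .
  have bm[measurable]: "(\<lambda>x. x) \<in> measurable (borel_on \<Sigma>) borel"
    by (simp add: measurable_restrict_space1)
  have fm'[measurable]: "f \<in> borel_measurable (borel_on \<Sigma>)"
    by (simp add: measurable_restrict_space1)
  have mn: "(\<lambda>z. norm (fst z - snd z)) \<in> borel_measurable \<gamma>"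
    using measurable_compose[OF measurable_fst bm, of "borel_on \<Sigma>"]
      measurable_compose[OF measurable_snd bm, of "borel_on \<Sigma>"] by measurable
  have I': "(\<integral>\<^sup>+z. ennreal (norm (fst z - snd z)) \<partial>\<gamma>) < ennreal e"
    using I by (simp add: case_prod_beta')
  have iN: "integrable \<gamma> (\<lambda>z. norm (fst z - snd z))"
    using I' mn by (intro integrableI_bounded) (auto intro: order.strict_trans)
  have "ennreal (\<integral>z. norm (fst z - snd z) \<partial>\<gamma>) < ennreal e"
    using I' iN by (subst nn_integral_eq_integral[symmetric]) auto
  then have IN: "(\<integral>z. norm (fst z - snd z) \<partial>\<gamma>) \<le> e"
    by (subst (asm) ennreal_less_iff) (auto intro: integral_nonneg_AE)
  have iP: "integrable P f" and iQ: "integrable Q f"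
    using lipschitz_integrable_prob_measures[OF _ lip B] P Q by auto
  have i1: "integrable \<gamma> (\<lambda>z. f (fst z))"
    using iP unfolding dP[symmetric] by (subst (asm) integrable_distr_eq) auto
  have i2: "integrable \<gamma> (\<lambda>z. f (snd z))"
    using iQ unfolding dQ[symmetric] by (subst (asm) integrable_distr_eq) auto
  have e1: "(\<integral>x. f x \<partial>P) = (\<integral>z. f (fst z) \<partial>\<gamma>)"
    unfolding dP[symmetric] by (rule integral_distr) auto
  have e2: "(\<integral>x. f x \<partial>Q) = (\<integral>z. f (snd z) \<partial>\<gamma>)"
    unfolding dQ[symmetric] by (rule integral_distr) auto
  have "(\<integral>z. f (fst z) \<partial>\<gamma>) - (\<integral>z. f (snd z) \<partial>\<gamma>) = (\<integral>z. f (fst z) - f (snd z) \<partial>\<gamma>)"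
    using i1 i2 by simp
  also have "\<dots> \<le> (\<integral>z. L * norm (fst z - snd z) \<partial>\<gamma>)"
  proof (intro integral_mono)
    fix z :: "'a \<times> 'a"
    have "\<bar>f (fst z) - f (snd z)\<bar> \<le> L * norm (fst z - snd z)"
      using lipschitz_onD[OF lip, of "fst z" "snd z"] by (simp add: dist_norm)
    then show "f (fst z) - f (snd z) \<le> L * norm (fst z - snd z)" by linarith
  qed (use i1 i2 iN in auto)
  also have "\<dots> \<le> L * e" using IN L by (simp add: mult_left_mono)
  finally show ?thesis using e1 e2 by linarith
qed

text \<open>A thickening by \<open>d\<close> maps a superlevel set of \<open>f\<close> into the
  superlevel set of \<open>f + L * d\<close> at the same level. The distance thus compares the
  measures of level sets up to an additive \<open>d\<close>; integrating over levels in an interval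
  of length \<open>2 * B\<close> adds \<open>2 * B * d\<close> to the shift
  \<open>L * d\<close>.\<close>

lemma levy_prokhorov_lipschitz:
  fixes f :: "'a::euclidean_space \<Rightarrow> real"
  assumes P: "P \<in> prob_measures \<Sigma>" and Q: "Q \<in> prob_measures \<Sigma>"
    and lip: "L-lipschitz_on UNIV f" and B: "\<And>x. \<bar>f x\<bar> \<le> B"
    and LP: "levy_prokhorov \<Sigma> P Q < e"
  shows "(\<integral>x. f x \<partial>P) \<le> (\<integral>x. f x \<partial>Q) + (L + 2 * B) * e"
proof -
  interpret P: prob_space P using prob_measuresD(1)[OF P] .
  interpret Q: prob_space Q using prob_measuresD(1)[OF Q] .
  have sp: "space P = \<Sigma>" "space Q = \<Sigma>" using P Q by (auto simp: prob_measuresD(3))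
  let ?D = "{\<epsilon>. \<epsilon> > 0 \<and> (\<forall>S\<in>sets (borel_on \<Sigma>).
    emeasure Q S \<le> outer_measure_of P (thickening \<Sigma> \<epsilon> S) + ennreal \<epsilon> \<and>
    emeasure P S \<le> outer_measure_of Q (thickening \<Sigma> \<epsilon> S) + ennreal \<epsilon>)}"
  \<comment> \<open>The infimum is taken over a nonempty set, since 1 exceeds no probability bound;
    only then does a value below \<open>e\<close> produce an admissible radius below
    \<open>e\<close>.\<close>
  have "1 \<in> ?D"
    using P.emeasure_le_1 Q.emeasure_le_1 by (auto intro: order.trans[OF _ add_increasing])
  then obtain d where "d \<in> ?D" and de: "d < e"
    using LP cInf_lessD[of ?D e] unfolding levy_prokhorov_def by blast
  then have d: "d > 0" and dS: "\<And>S. S \<in> sets (borel_on \<Sigma>) \<Longrightarrow>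
      emeasure P S \<le> outer_measure_of Q (thickening \<Sigma> d S) + ennreal d" by auto
  have L: "L \<ge> 0" using lipschitz_on_nonneg[OF lip] .
  have B0: "B \<ge> 0" using B[of undefined] by simp
  have iP: "integrable P f" and iQ: "integrable Q f"
    using lipschitz_integrable_prob_measures[OF _ lip B] P Q by auto
  note [measurable] = borel_measurable_integrable[OF iP] borel_measurable_integrable[OF iQ]
  \<comment> \<open>\<open>u\<close> shifts \<open>f\<close> into the interval from 0 to
    \<open>2 * B\<close>, as the layer-cake formula asks for nonnegative functions; \<open>v\<close>
    is \<open>u\<close> raised by the oscillation \<open>L * d\<close>.\<close>
  define u where "u x = f x + B" for x
  define v where "v x = f x + B + L * d" for x
  have [measurable]: "u \<in> borel_measurable P" "v \<in> borel_measurable Q"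
    unfolding u_def v_def by measurable
  have u0: "0 \<le> u x" and u1: "u x \<le> 2 * B" for x using B[of x] by (auto simp: u_def)
  have v0: "0 \<le> v x" for x using u0[of x] L d by (simp add: u_def v_def)
  have step: "emeasure P {x \<in> space P. t < u x} \<le> emeasure Q {x \<in> space Q. t < v x} + ennreal d" for t
  proof -
    let ?S = "{x \<in> space P. t < u x}"
    have "?S \<in> sets P" by measurable
    then have "?S \<in> sets (borel_on \<Sigma>)" using prob_measuresD(2)[OF P] by simp
    then have "emeasure P ?S \<le> outer_measure_of Q (thickening \<Sigma> d ?S) + ennreal d" by (rule dS)
    \<comment> \<open>The thickening may fail to be measurable; enclosing it in a level set of
      \<open>v\<close>, which is measurable, converts the outer measure into
      \<open>emeasure\<close>.\<close>
    also have "outer_measure_of Q (thickening \<Sigma> d ?S) \<le> outer_measure_of Q {x \<in> space Q. t < v x}"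
    proof (intro outer_measure_of_mono subsetI)
      fix y assume "y \<in> thickening \<Sigma> d ?S"
      then obtain x where x: "y \<in> \<Sigma>" "t < u x" "norm (y - x) \<le> d"
        unfolding thickening_def by auto
      have "\<bar>f x - f y\<bar> \<le> L * dist x y"
        using lipschitz_onD[OF lip, of x y] by (simp add: dist_real_def)
      also have "\<dots> \<le> L * d" using x(3) L by (intro mult_left_mono) (auto simp: dist_norm norm_minus_commute)
      finally have "u x \<le> v y" by (auto simp: u_def v_def)
      then show "y \<in> {x \<in> space Q. t < v x}" using x sp by auto
    qed
    also have "\<dots> = emeasure Q {x \<in> space Q. t < v x}"
      by (intro outer_measure_of_eq) measurable
    finally show ?thesis by (simp add: add_mono)
  qed
  have iu: "integrable P u" "integrable Q v" unfolding u_def v_def using iP iQ by auto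
  have "ennreal (\<integral>x. u x \<partial>P) = (\<integral>\<^sup>+x. ennreal (u x) \<partial>P)"
    using u0 iu by (intro nn_integral_eq_integral[symmetric]) auto
  also have "\<dots> = (\<integral>\<^sup>+x. ennreal (min (u x) (2 * B)) \<partial>P)"
    using u1 by (simp add: min_absorb1)
  also have "\<dots> = (\<integral>\<^sup>+t\<in>{0..2 * B}. emeasure P {x \<in> space P. t < u x} \<partial>lborel)"
    using u0 B0 by (intro layer_cake P.sigma_finite_measure_axioms) auto
  also have "\<dots> \<le> (\<integral>\<^sup>+t. emeasure Q {x \<in> space Q. t < v x} * indicator {0..2 * B} t +
      ennreal d * indicator {0..2 * B} t \<partial>lborel)"
    using step by (intro nn_integral_mono) (auto simp: indicator_def)
  also have "\<dots> = (\<integral>\<^sup>+t\<in>{0..2 * B}. emeasure Q {x \<in> space Q. t < v x} \<partial>lborel) +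
      ennreal d * ennreal (2 * B)"
    using B0 by (subst nn_integral_add) (auto simp: nn_integral_cmult)
  also have "(\<integral>\<^sup>+t\<in>{0..2 * B}. emeasure Q {x \<in> space Q. t < v x} \<partial>lborel) =
      (\<integral>\<^sup>+x. ennreal (min (v x) (2 * B)) \<partial>Q)"
    using v0 B0 by (intro layer_cake[symmetric] Q.sigma_finite_measure_axioms) auto
  also have "\<dots> \<le> (\<integral>\<^sup>+x. ennreal (v x) \<partial>Q)"
    by (intro nn_integral_mono ennreal_leI) auto
  also have "\<dots> = ennreal (\<integral>x. v x \<partial>Q)"
    using v0 iu by (intro nn_integral_eq_integral) auto
  also have "ennreal (\<integral>x. v x \<partial>Q) + ennreal d * ennreal (2 * B) = ennreal ((\<integral>x. v x \<partial>Q) + d * (2 * B))"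
    using v0 d B0 by (simp add: ennreal_mult ennreal_plus integral_nonneg_AE)
  finally have "ennreal (\<integral>x. u x \<partial>P) \<le> ennreal ((\<integral>x. v x \<partial>Q) + d * (2 * B))" by (simp add: add_right_mono)
  then have "(\<integral>x. u x \<partial>P) \<le> (\<integral>x. v x \<partial>Q) + d * (2 * B)"
    using v0 d B0 by (subst (asm) ennreal_le_iff) (auto intro!: add_nonneg_nonneg integral_nonneg_AE)
  then have "(\<integral>x. f x \<partial>P) \<le> (\<integral>x. f x \<partial>Q) + (L + 2 * B) * d"
    using iP iQ by (simp add: u_def v_def P.prob_space Q.prob_space algebra_simps)
  also have "(L + 2 * B) * d \<le> (L + 2 * B) * e" using L B0 de by (intro mult_left_mono) auto
  finally show ?thesis by simp
qed

text \<open>The error \<open>(L + 2 * B) * e\<close> in \<open>near\<close> is the common form of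
  closeness that both distances imply. The inequality of Donsker and Varadhan for the nearby
  \<open>Q\<close> then passes to \<open>P'\<close> as the error tends to 0.\<close>

lemma KL_lower_semicontinuous:
  fixes P P' :: "'a::euclidean_space measure" and r :: real
  assumes \<Sigma>: "\<Sigma> \<in> sets borel" and P: "P \<in> prob_measures \<Sigma>" and P': "P' \<in> prob_measures \<Sigma>"
    and near: "\<And>e. e > 0 \<Longrightarrow> \<exists>Q\<in>prob_measures \<Sigma>. KL Q P < ereal (r + e) \<and>
      (\<forall>f L B. L-lipschitz_on UNIV f \<longrightarrow> (\<forall>x. \<bar>f x\<bar> \<le> B) \<longrightarrow>
        (\<integral>x. f x \<partial>P') \<le> (\<integral>x. f x \<partial>Q) + (L + 2 * B) * e)"
  shows "KL P' P \<le> ereal r"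
proof (rule KL_le_if_Donsker_Varadhan)
  show "prob_space P" "prob_space P'" "sets P' = sets P"
    using P P' by (auto simp: prob_measuresD)
next
  fix f :: "'a \<Rightarrow> real" and B assume f: "f \<in> borel_measurable P" "\<And>x. \<bar>f x\<bar> \<le> B"
  show "(\<integral>x. f x \<partial>P') \<le> ln (\<integral>x. exp (f x) \<partial>P) + r"
  proof (rule Donsker_Varadhan_from_lipschitz[OF \<Sigma> P P' _ f])
    fix f :: "'a \<Rightarrow> real" and L B assume lip: "L-lipschitz_on UNIV f" and B: "\<And>x. \<bar>f x\<bar> \<le> B"
    interpret P: prob_space P using prob_measuresD(1)[OF P] .
    have L: "L \<ge> 0" using lipschitz_on_nonneg[OF lip] .
    have B0: "B \<ge> 0" using B[of undefined] by simp
    show "(\<integral>x. f x \<partial>P') \<le> ln (\<integral>x. exp (f x) \<partial>P) + r"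
    proof (rule field_le_epsilon)
      fix e :: real assume "e > 0"
      \<comment> \<open>The excess \<open>d\<close> of the divergence and the error
        \<open>(L + 2 * B) * d\<close> of the integral add up to \<open>e\<close>.\<close>
      define d where "d = e / (1 + L + 2 * B)"
      have d: "d > 0" "(1 + L + 2 * B) * d = e" using \<open>e > 0\<close> L B0 by (auto simp: d_def)
      obtain Q where Q: "Q \<in> prob_measures \<Sigma>" "KL Q P < ereal (r + d)"
        "(\<integral>x. f x \<partial>P') \<le> (\<integral>x. f x \<partial>Q) + (L + 2 * B) * d"
        using near[OF d(1)] lip B by blast
      obtain h where h: "h \<in> borel_measurable P" "\<And>x. 0 \<le> h x" "Q = density P (\<lambda>x. ennreal (h x))"
        "integrable P (\<lambda>x. h x * ln (h x))" "(\<integral>x. h x * ln (h x) \<partial>P) \<le> r + d"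
        using KL_leE[OF P Q(1), of "r + d"] Q(2) by (auto simp: less_imp_le)
      have "(\<integral>x. f x \<partial>Q) \<le> ln (\<integral>x. exp (f x) \<partial>P) + (\<integral>x. h x * ln (h x) \<partial>P)"
        unfolding h(3)
      proof (rule P.Donsker_Varadhan_le[OF h(1,2) _ h(4) _ B])
        show "prob_space (density P (\<lambda>x. ennreal (h x)))"
          using prob_measuresD(1)[OF Q(1)] h(3) by simp
        show "f \<in> borel_measurable P"
          using lipschitz_integrable_prob_measures[OF P lip B] by auto
      qed
      then show "(\<integral>x. f x \<partial>P') \<le> ln (\<integral>x. exp (f x) \<partial>P) + r + e"
        using Q(3) h(5) d(2) by (simp add: algebra_simps)
    qed
  qed
qed

section \<open>Intersections of the balls of the smoothed divergences\<close>

text \<open>The image of \<open>P\<close> on the diagonal is a coupling of cost 0.\<close>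

lemma wasserstein_self:
  assumes P: "P \<in> prob_measures \<Sigma>"
  shows "wasserstein \<Sigma> P P = 0"
proof -
  have s[measurable_cong]: "sets P = sets (borel_on \<Sigma>)" using prob_measuresD(2)[OF P] .
  let ?\<gamma> = "distr P (borel_on \<Sigma> \<Otimes>\<^sub>M borel_on \<Sigma>) (\<lambda>x. (x, x))"
  have bm[measurable]: "(\<lambda>x. x) \<in> measurable (borel_on \<Sigma>) borel"
    by (simp add: measurable_restrict_space1)
  have "?\<gamma> \<in> couplings \<Sigma> P P"
    using s by (auto simp: couplings_def distr_distr comp_def intro!: distr_id2)
  moreover have "(\<integral>\<^sup>+(\<xi>', \<xi>). ennreal (norm (\<xi>' - \<xi>)) \<partial>?\<gamma>) = 0"
  proof -
    have mn[measurable]: "(\<lambda>z. norm (fst z - snd z)) \<in> borel_measurable (borel_on \<Sigma> \<Otimes>\<^sub>M borel_on \<Sigma>)"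
      using measurable_compose[OF measurable_fst bm, of "borel_on \<Sigma>"]
        measurable_compose[OF measurable_snd bm, of "borel_on \<Sigma>"] by measurable
    show ?thesis by (simp add: case_prod_beta' nn_integral_distr)
  qed
  ultimately have "wasserstein \<Sigma> P P \<le> 0" 
    unfolding wasserstein_def by (intro INF_lower2[of ?\<gamma>]) simp_all
  then show ?thesis by simp
qed

lemma levy_prokhorov_self:
  assumes P: "P \<in> prob_measures \<Sigma>"
  shows "levy_prokhorov \<Sigma> P P = 0"
proof -
  have sp: "space P = \<Sigma>" "sets P = sets (borel_on \<Sigma>)" using P by (auto simp: prob_measuresD)
  have "emeasure P S \<le> outer_measure_of P (thickening \<Sigma> e S) + ennreal e"
    if S: "S \<in> sets (borel_on \<Sigma>)" and "e > 0" for e S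
  proof -
    have "S \<subseteq> \<Sigma>" using S sets.sets_into_space[of S P] sp by auto
    then have "S \<subseteq> thickening \<Sigma> e S" using \<open>e > 0\<close> by (force simp: thickening_def)
    then have "outer_measure_of P S \<le> outer_measure_of P (thickening \<Sigma> e S)" by (rule outer_measure_of_mono)
    then show ?thesis using S sp by (simp add: add_increasing2)
  qed
  then have "{\<epsilon>. \<epsilon> > 0 \<and> (\<forall>S\<in>sets (borel_on \<Sigma>).
    emeasure P S \<le> outer_measure_of P (thickening \<Sigma> \<epsilon> S) + ennreal \<epsilon> \<and>
    emeasure P S \<le> outer_measure_of P (thickening \<Sigma> \<epsilon> S) + ennreal \<epsilon>)} = {0<..}"
    by auto
  then show ?thesis unfolding levy_prokhorov_def by simp
qed

text \<open>In one direction \<open>P'\<close> is itself a candidate in the infimum, being at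
  distance 0. In the other, each radius yields a candidate with divergence just above
  \<open>r\<close>, and lower semicontinuity applies.\<close>

lemma KL_neighbourhood_le_iff:
  fixes P P' :: "'a::euclidean_space measure" and r :: real
  assumes \<Sigma>: "\<Sigma> \<in> sets borel" and P: "P \<in> prob_measures \<Sigma>" and P': "P' \<in> prob_measures \<Sigma>"
  shows KL_W_le_iff: "(\<forall>e>0. KL_W \<Sigma> e P' P \<le> ereal r) \<longleftrightarrow> KL P' P \<le> ereal r"
    and KL_LP_le_iff: "(\<forall>e>0. KL_LP \<Sigma> e P' P \<le> ereal r) \<longleftrightarrow> KL P' P \<le> ereal r"
proof -
  show "(\<forall>e>0. KL_W \<Sigma> e P' P \<le> ereal r) \<longleftrightarrow> KL P' P \<le> ereal r"
  proof safe
    fix e :: real assume "e > 0" "KL P' P \<le> ereal r"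
    then show "KL_W \<Sigma> e P' P \<le> ereal r"
      unfolding KL_W_def using P' by (intro INF_lower2[of P']) (auto simp: wasserstein_self)
  next
    assume a: "\<forall>e>0. KL_W \<Sigma> e P' P \<le> ereal r"
    show "KL P' P \<le> ereal r"
    proof (rule KL_lower_semicontinuous[OF \<Sigma> P P'])
      fix e :: real assume e: "e > 0"
      \<comment> \<open>Half the radius, because the estimate for Lipschitz functions asks for a
        distance strictly below \<open>e\<close>, whereas membership in the ball gives a weak
        inequality.\<close>
      have "KL_W \<Sigma> (e / 2) P' P \<le> ereal r" using a e by simp
      also have "ereal r < ereal (r + e)" using e by simp
      finally obtain Q where Q: "Q \<in> prob_measures \<Sigma>" "wasserstein \<Sigma> P' Q \<le> ennreal (e / 2)" "KL Q P < ereal (r + e)"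
        unfolding KL_W_def INF_less_iff by blast
      have W: "wasserstein \<Sigma> P' Q < ennreal e"
        using e by (intro order.strict_trans1[OF Q(2)]) (auto simp: ennreal_less_iff)
      have "(\<integral>x. f x \<partial>P') \<le> (\<integral>x. f x \<partial>Q) + (L + 2 * B) * e"
        if "L-lipschitz_on UNIV f" "\<forall>x. \<bar>f x\<bar> \<le> B" for f :: "'a \<Rightarrow> real" and L B
      proof -
        have "B \<ge> 0" using that(2) by (meson abs_ge_zero order_trans)
        then have "0 \<le> B * e" using e by simp
        then show ?thesis
          using wasserstein_lipschitz[OF P' Q(1) that(1) _ W, of B] that(2) by (simp add: distrib_right)
      qed
      then show "\<exists>Q\<in>prob_measures \<Sigma>. KL Q P < ereal (r + e) \<and>
        (\<forall>f L B. L-lipschitz_on UNIV f \<longrightarrow> (\<forall>x. \<bar>f x\<bar> \<le> B) \<longrightarrow>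
          (\<integral>x. f x \<partial>P') \<le> (\<integral>x. f x \<partial>Q) + (L + 2 * B) * e)"
        using Q by blast
    qed
  qed
  show "(\<forall>e>0. KL_LP \<Sigma> e P' P \<le> ereal r) \<longleftrightarrow> KL P' P \<le> ereal r"
  proof safe
    fix e :: real assume "e > 0" "KL P' P \<le> ereal r"
    then show "KL_LP \<Sigma> e P' P \<le> ereal r"
      unfolding KL_LP_def using P' by (intro INF_lower2[of P']) (auto simp: levy_prokhorov_self)
  next
    assume a: "\<forall>e>0. KL_LP \<Sigma> e P' P \<le> ereal r"
    show "KL P' P \<le> ereal r"
    proof (rule KL_lower_semicontinuous[OF \<Sigma> P P'])
      fix e :: real assume e: "e > 0"
      have "KL_LP \<Sigma> (e / 2) P' P \<le> ereal r" using a e by simp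
      also have "ereal r < ereal (r + e)" using e by simp
      finally obtain Q where Q: "Q \<in> prob_measures \<Sigma>" "levy_prokhorov \<Sigma> P' Q \<le> e / 2" "KL Q P < ereal (r + e)"
        unfolding KL_LP_def INF_less_iff by blast
      have "levy_prokhorov \<Sigma> P' Q < e" using e Q(2) by linarith
      then show "\<exists>Q\<in>prob_measures \<Sigma>. KL Q P < ereal (r + e) \<and>
        (\<forall>f L B. L-lipschitz_on UNIV f \<longrightarrow> (\<forall>x. \<bar>f x\<bar> \<le> B) \<longrightarrow>
          (\<integral>x. f x \<partial>P') \<le> (\<integral>x. f x \<partial>Q) + (L + 2 * B) * e)"
        using Q levy_prokhorov_lipschitz[OF P' Q(1)] by blast
    qed
  qed
qed

section \<open>The lower bound of Sanov's theorem\<close>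

text \<open>Independence means that the joint law is the product of the marginals; here the joint
  law is that of the identity on the product space.\<close>

lemma (in prob_space) indep_vars_PiM_coordinates:
  assumes "finite I" "I \<noteq> {}"
  shows "prob_space.indep_vars (PiM I (\<lambda>_. M)) (\<lambda>_. M) (\<lambda>i \<omega>. \<omega> i) I"
proof -
  interpret PP: product_prob_space "\<lambda>_. M" I by unfold_locales
  have "distr (PiM I (\<lambda>_. M)) (PiM I (\<lambda>_. M)) (\<lambda>x. \<lambda>i\<in>I. x i) =
      distr (PiM I (\<lambda>_. M)) (PiM I (\<lambda>_. M)) (\<lambda>x. x)"
    by (intro distr_cong) (auto simp: space_PiM)
  also have "\<dots> = PiM I (\<lambda>_. M)" by (rule distr_id)
  also have "\<dots> = PiM I (\<lambda>i. distr (PiM I (\<lambda>_. M)) M (\<lambda>\<omega>. \<omega> i))"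
  proof (intro PiM_cong refl)
    fix i assume "i \<in> I"
    then show "M = distr (PiM I (\<lambda>_. M)) M (\<lambda>\<omega>. \<omega> i)"
      using distr_PiM_component[of I "\<lambda>_. M" i] prob_space_axioms by simp
  qed
  finally show ?thesis
    using assms by (subst PP.P.indep_vars_iff_distr_eq_PiM') auto
qed

lemma (in prob_space) Hoeffding_PiM:
  assumes f[measurable]: "f \<in> borel_measurable M" and B: "\<And>x. x \<in> space M \<Longrightarrow> \<bar>f x\<bar> \<le> B"
    and d: "d \<ge> 0" and N: "N > 0"
  shows "measure (PiM {..<N} (\<lambda>_. M)) {\<xi> \<in> space (PiM {..<N} (\<lambda>_. M)).
      d \<le> \<bar>(\<Sum>i<N. f (\<xi> i)) / real N - (\<integral>x. f x \<partial>M)\<bar>} \<le> 2 * exp (- 2 * real N * d\<^sup>2 / (2 * (\<bar>B\<bar> + 1))\<^sup>2)"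
proof -
  let ?P = "PiM {..<N} (\<lambda>_. M)"
  interpret PP: product_prob_space "\<lambda>_. M" "{..<N}" by unfold_locales
  have comp: "distr ?P M (\<lambda>\<omega>. \<omega> i) = M" if "i < N" for i
    using that by (intro distr_PiM_component) (auto simp: prob_space_axioms)
  have dist: "distr ?P borel (\<lambda>\<omega>. f (\<omega> i)) = distr M borel f" if "i < N" for i
    using that by (subst (2) comp[OF that, symmetric], subst distr_distr) (auto simp: comp_def)
  \<comment> \<open>The range is widened by 1 on each side because the inequality is applied with a
    nondegenerate interval, also when \<open>B = 0\<close>.\<close>
  interpret H: Hoeffding_ineq_iid ?P "{..<N}" "\<lambda>i \<omega>. f (\<omega> i)" "\<lambda>\<omega>. f (\<omega> 0)" "- (\<bar>B\<bar> + 1)" "\<bar>B\<bar> + 1"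
    "PP.P.expectation (\<lambda>\<omega>. f (\<omega> 0))"
  proof unfold_locales
    show "PP.P.indep_vars (\<lambda>_. borel) (\<lambda>i \<omega>. f (\<omega> i)) {..<N}"
      using N by (intro PP.P.indep_vars_compose2[OF indep_vars_PiM_coordinates]) auto
    show "AE x in ?P. f (x 0) \<in> {- (\<bar>B\<bar> + 1)..\<bar>B\<bar> + 1}"
    proof (rule AE_I2)
      fix x assume "x \<in> space ?P"
      then have "x 0 \<in> space M" using N by (auto simp: space_PiM)
      from B[OF this] show "f (x 0) \<in> {- (\<bar>B\<bar> + 1)..\<bar>B\<bar> + 1}" by auto
    qed
  qed (use N dist in auto)
  have mean: "(\<integral>\<omega>. f (\<omega> 0) \<partial>?P) = (\<integral>x. f x \<partial>M)"
  proof -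
    have "(\<integral>x. f x \<partial>M) = (\<integral>x. f x \<partial>distr ?P M (\<lambda>\<omega>. \<omega> 0))" using comp[OF N] by simp
    also have "\<dots> = (\<integral>\<omega>. f (\<omega> 0) \<partial>?P)" using N by (intro integral_distr) auto
    finally show ?thesis by simp
  qed
  have ne: "{..<N} \<noteq> {}" and ab: "- (\<bar>B\<bar> + 1) < \<bar>B\<bar> + 1" using N by auto
  have diff: "\<bar>B\<bar> + 1 - - (\<bar>B\<bar> + 1) = 2 * (\<bar>B\<bar> + 1)" by simp
  show ?thesis
    using H.Hoeffding_ineq_abs_ge'[OF d ab ne] unfolding mean diff card_lessThan .
qed

lemma (in prob_space) weak_law_PiM:
  assumes "f \<in> borel_measurable M" "\<And>x. x \<in> space M \<Longrightarrow> \<bar>f x\<bar> \<le> B" "d > 0"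
  shows "(\<lambda>N. measure (PiM {..<N} (\<lambda>_. M)) {\<xi> \<in> space (PiM {..<N} (\<lambda>_. M)).
      d \<le> \<bar>(\<Sum>i<N. f (\<xi> i)) / real N - (\<integral>x. f x \<partial>M)\<bar>}) \<longlonglongrightarrow> 0"
proof -
  define k where "k = 2 * d\<^sup>2 / (2 * (\<bar>B\<bar> + 1))\<^sup>2"
  have "k > 0" using assms(3) unfolding k_def by (intro divide_pos_pos) auto
  have "(\<lambda>N. 2 * exp (- k) ^ N) \<longlonglongrightarrow> 2 * 0"
    using \<open>k > 0\<close> by (intro tendsto_mult tendsto_const LIMSEQ_realpow_zero) auto
  then have 1: "(\<lambda>N. 2 * exp (- k) ^ N) \<longlonglongrightarrow> 0" by simp
  have 2: "eventually (\<lambda>N. measure (PiM {..<N} (\<lambda>_. M)) {\<xi> \<in> space (PiM {..<N} (\<lambda>_. M)).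
      d \<le> \<bar>(\<Sum>i<N. f (\<xi> i)) / real N - (\<integral>x. f x \<partial>M)\<bar>} \<le> 2 * exp (- k) ^ N) sequentially"
    using eventually_gt_at_top[of 0]
  proof eventually_elim
    case (elim N)
    have "exp (- 2 * real N * d\<^sup>2 / (2 * (\<bar>B\<bar> + 1))\<^sup>2) = exp (- k) ^ N"
      by (simp add: k_def exp_of_nat_mult[symmetric] algebra_simps)
    then show ?case using Hoeffding_PiM[OF assms(1,2) less_imp_le[OF assms(3)] elim] by simp
  qed
  show ?thesis
    by (rule tendsto_sandwich[OF _ 2 tendsto_const 1]) auto
qed

text \<open>Product measures are determined by their values on boxes, and there the integral of the
  product density factorises.\<close>

lemma (in prob_space) PiM_density:
  fixes h :: "'a \<Rightarrow> real"
  assumes [measurable]: "h \<in> borel_measurable M" and "finite I"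
    and "prob_space (density M (\<lambda>x. ennreal (h x)))"
  shows "PiM I (\<lambda>_. density M (\<lambda>x. ennreal (h x))) = density (PiM I (\<lambda>_. M)) (\<lambda>\<xi>. \<Prod>i\<in>I. ennreal (h (\<xi> i)))"
proof -
  let ?Q = "density M (\<lambda>x. ennreal (h x))"
  interpret Q: prob_space ?Q by fact
  interpret PQ: product_prob_space "\<lambda>_. ?Q" I by unfold_locales
  interpret PP: product_prob_space "\<lambda>_. M" I by unfold_locales
  show ?thesis
  proof (rule PQ.PiM_eqI[symmetric])
    show "finite I" by fact
    show "sets (density (PiM I (\<lambda>_. M)) (\<lambda>\<xi>. \<Prod>i\<in>I. ennreal (h (\<xi> i)))) = sets (PiM I (\<lambda>_. ?Q))"
      by (simp cong: sets_PiM_cong)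
    fix A assume "\<And>i. i \<in> I \<Longrightarrow> A i \<in> sets ?Q"
    then have A[measurable]: "\<And>i. i \<in> I \<Longrightarrow> A i \<in> sets M" by simp
    have mA: "Pi\<^sub>E I A \<in> sets (PiM I (\<lambda>_. M))"
      using \<open>finite I\<close> A by (rule sets_PiM_I_finite)
    have "emeasure (density (PiM I (\<lambda>_. M)) (\<lambda>\<xi>. \<Prod>i\<in>I. ennreal (h (\<xi> i)))) (Pi\<^sub>E I A) =
        (\<integral>\<^sup>+\<xi>. (\<Prod>i\<in>I. ennreal (h (\<xi> i))) * indicator (Pi\<^sub>E I A) \<xi> \<partial>PiM I (\<lambda>_. M))"
      using mA by (intro emeasure_density) auto
    also have "\<dots> = (\<integral>\<^sup>+\<xi>. (\<Prod>i\<in>I. ennreal (h (\<xi> i)) * indicator (A i) (\<xi> i)) \<partial>PiM I (\<lambda>_. M))"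
    proof (intro nn_integral_cong)
      fix \<xi> assume "\<xi> \<in> space (PiM I (\<lambda>_. M))"
      then have "(indicator (Pi\<^sub>E I A) \<xi> :: ennreal) = (\<Prod>i\<in>I. indicator (A i) (\<xi> i))"
        using \<open>finite I\<close> by (auto simp: space_PiM PiE_iff indicator_def)
      then show "(\<Prod>i\<in>I. ennreal (h (\<xi> i))) * indicator (Pi\<^sub>E I A) \<xi> =
          (\<Prod>i\<in>I. ennreal (h (\<xi> i)) * indicator (A i) (\<xi> i))"
        by (simp add: prod.distrib)
    qed
    also have "\<dots> = (\<Prod>i\<in>I. \<integral>\<^sup>+x. ennreal (h x) * indicator (A i) x \<partial>M)"
      using \<open>finite I\<close> by (intro PP.product_nn_integral_prod) auto
    also have "\<dots> = (\<Prod>i\<in>I. emeasure ?Q (A i))"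
      by (intro prod.cong refl emeasure_density[symmetric]) auto
    finally show "emeasure (density (PiM I (\<lambda>_. M)) (\<lambda>\<xi>. \<Prod>i\<in>I. ennreal (h (\<xi> i)))) (Pi\<^sub>E I A) =
      (\<Prod>i\<in>I. emeasure ?Q (A i))" .
  qed
qed

text \<open>Where the log-likelihood ratio is at most \<open>N * \<kappa>\<close>, the product
  density is at most \<open>exp (N * \<kappa>)\<close>, so an event that is likely under the tilted
  law cannot be less likely than \<open>exp (- (N * \<kappa>))\<close> times that probability.
  Positivity of \<open>h\<close> permits writing the product as an exponential of a sum.\<close>

lemma (in prob_space) change_of_measure_PiM:
  assumes [measurable]: "h \<in> borel_measurable M" and h: "\<And>x. x \<in> space M \<Longrightarrow> 0 < h x"
    and Q: "prob_space (density M (\<lambda>x. ennreal (h x)))"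
    and E[measurable]: "E \<in> sets (PiM {..<N} (\<lambda>_. M))"
  shows "exp (- (real N * \<kappa>)) * measure (PiM {..<N} (\<lambda>_. density M (\<lambda>x. ennreal (h x))))
      {\<xi> \<in> E. (\<Sum>i<N. ln (h (\<xi> i))) \<le> real N * \<kappa>} \<le> measure (PiM {..<N} (\<lambda>_. M)) E"
proof -
  let ?Q = "density M (\<lambda>x. ennreal (h x))" and ?I = "{..<N}"
  interpret Q: prob_space ?Q by fact
  interpret PQ: product_prob_space "\<lambda>_. ?Q" ?I by unfold_locales
  interpret PP: product_prob_space "\<lambda>_. M" ?I by unfold_locales
  let ?E = "{\<xi> \<in> E. (\<Sum>i<N. ln (h (\<xi> i))) \<le> real N * \<kappa>}"
  have "?E = {\<xi> \<in> space (PiM ?I (\<lambda>_. M)). \<xi> \<in> E \<and> (\<Sum>i<N. ln (h (\<xi> i))) \<le> real N * \<kappa>}"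
    using sets.sets_into_space[OF E] by auto
  also have "\<dots> \<in> sets (PiM ?I (\<lambda>_. M))" by measurable
  finally have E'[measurable]: "?E \<in> sets (PiM ?I (\<lambda>_. M))" .
  have "ennreal (measure (PiM ?I (\<lambda>_. ?Q)) ?E) = emeasure (PiM ?I (\<lambda>_. ?Q)) ?E"
    by (rule PQ.P.emeasure_eq_measure[symmetric])
  also have "\<dots> = (\<integral>\<^sup>+\<xi>. (\<Prod>i<N. ennreal (h (\<xi> i))) * indicator ?E \<xi> \<partial>PiM ?I (\<lambda>_. M))"
    unfolding PiM_density[OF assms(1) finite_lessThan Q] by (intro emeasure_density) auto
  also have "\<dots> \<le> (\<integral>\<^sup>+\<xi>. ennreal (exp (real N * \<kappa>)) * indicator E \<xi> \<partial>PiM ?I (\<lambda>_. M))"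
  proof (intro nn_integral_mono)
    fix \<xi> assume xi: "\<xi> \<in> space (PiM ?I (\<lambda>_. M))"
    show "(\<Prod>i<N. ennreal (h (\<xi> i))) * indicator ?E \<xi> \<le> ennreal (exp (real N * \<kappa>)) * indicator E \<xi>"
    proof (cases "\<xi> \<in> ?E")
      case True
      have pos: "0 < h (\<xi> i)" if "i < N" for i
        using xi that by (intro h) (auto simp: space_PiM)
      have "(\<Prod>i<N. ennreal (h (\<xi> i))) = ennreal (\<Prod>i<N. h (\<xi> i))"
        using pos by (intro prod_ennreal) (auto simp: less_imp_le)
      also have "(\<Prod>i<N. h (\<xi> i)) = exp (\<Sum>i<N. ln (h (\<xi> i)))"
        using pos by (subst exp_sum) auto
      also have "ennreal \<dots> \<le> ennreal (exp (real N * \<kappa>))"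
        using True by (intro ennreal_leI) auto
      finally show ?thesis using True by auto
    qed auto
  qed
  also have "\<dots> = ennreal (exp (real N * \<kappa>)) * ennreal (measure (PiM ?I (\<lambda>_. M)) E)"
    by (simp add: nn_integral_cmult PP.P.emeasure_eq_measure)
  finally have "measure (PiM ?I (\<lambda>_. ?Q)) ?E \<le> exp (real N * \<kappa>) * measure (PiM ?I (\<lambda>_. M)) E"
    by (simp add: ennreal_mult[symmetric])
  then have "exp (- (real N * \<kappa>)) * measure (PiM ?I (\<lambda>_. ?Q)) ?E \<le>
      exp (- (real N * \<kappa>)) * (exp (real N * \<kappa>) * measure (PiM ?I (\<lambda>_. M)) E)"
    by (rule mult_left_mono) auto
  then show ?thesis by (simp add: mult.assoc[symmetric] exp_add[symmetric])
qed

section \<open>Empirical measures as random elements of the weak topology\<close>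

lemma empirical_measure_in_prob_measures:
  assumes "N > 0" "\<And>i. i < N \<Longrightarrow> \<xi> i \<in> \<Sigma>"
  shows "empirical_measure \<Sigma> N \<xi> \<in> prob_measures \<Sigma>"
proof -
  have m: "\<xi> \<in> measurable (uniform_count_measure {..<N}) (borel_on \<Sigma>)"
    using assms(2) by (auto simp: measurable_def sets_uniform_count_measure
      space_uniform_count_measure space_restrict_space)
  interpret U: prob_space "uniform_count_measure {..<N}"
    using assms(1) by (intro prob_space_uniform_count_measure) auto
  show ?thesis
    using U.prob_space_distr[OF m] by (simp add: prob_measures_def empirical_measure_def)
qed

lemma integral_empirical_measure:
  fixes f :: "'a::topological_space \<Rightarrow> real"
  assumes "\<And>i. i < N \<Longrightarrow> \<xi> i \<in> \<Sigma>" "continuous_on \<Sigma> f"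
  shows "(\<integral>x. f x \<partial>empirical_measure \<Sigma> N \<xi>) = (\<Sum>i<N. f (\<xi> i)) / real N"
proof -
  have m: "\<xi> \<in> measurable (uniform_count_measure {..<N}) (borel_on \<Sigma>)"
    using assms(1) by (auto simp: measurable_def sets_uniform_count_measure
      space_uniform_count_measure space_restrict_space)
  show ?thesis
    unfolding empirical_measure_def
    using borel_measurable_continuous_on_restrict[OF assms(2)]
    by (subst integral_distr[OF m]) (auto simp: integral_uniform_count_measure)
qed

lemma empirical_measure_cong:
  assumes "\<And>i. i < N \<Longrightarrow> \<xi> i = \<eta> i"
  shows "empirical_measure \<Sigma> N \<xi> = empirical_measure \<Sigma> N \<eta>"
  unfolding empirical_measure_def using assms
  by (intro distr_cong) (auto simp: space_uniform_count_measure)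

text \<open>A weakly open set may be an uncountable union of basic sets, so measurability of the
  event cannot be read off from the generators. Openness in the product topology of sequences
  survives arbitrary unions, and each generator depends continuously on finitely many
  coordinates.\<close>

lemma openin_empirical_measure:
  fixes \<Sigma> :: "'a::topological_space set"
  assumes G: "openin (weak_topology \<Sigma>) G" and N: "N > 0"
  shows "openin (top_of_set (UNIV \<rightarrow> \<Sigma>)) {\<xi> \<in> UNIV \<rightarrow> \<Sigma>. empirical_measure \<Sigma> N \<xi> \<in> G}"
proof -
  have "generate_topology_on {{P \<in> prob_measures \<Sigma>. (\<integral>\<xi>. f \<xi> \<partial>P) \<in> U} | (f :: 'a \<Rightarrow> real) U.
      continuous_on \<Sigma> f \<and> bounded (f ` \<Sigma>) \<and> open U} G"
    using G unfolding weak_topology_def openin_topology_generated_by_iff .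
  then show ?thesis
  proof induction
    case Empty
    show ?case by simp
  next
    case (Int a b)
    have "{\<xi> \<in> UNIV \<rightarrow> \<Sigma>. empirical_measure \<Sigma> N \<xi> \<in> a \<inter> b} =
      {\<xi> \<in> UNIV \<rightarrow> \<Sigma>. empirical_measure \<Sigma> N \<xi> \<in> a} \<inter> {\<xi> \<in> UNIV \<rightarrow> \<Sigma>. empirical_measure \<Sigma> N \<xi> \<in> b}" by auto
    then show ?case using openin_Int[OF Int.IH] by simp
  next
    case (UN K)
    have "{\<xi> \<in> UNIV \<rightarrow> \<Sigma>. empirical_measure \<Sigma> N \<xi> \<in> \<Union>K} =
      (\<Union>k\<in>K. {\<xi> \<in> UNIV \<rightarrow> \<Sigma>. empirical_measure \<Sigma> N \<xi> \<in> k})" by auto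
    then show ?case using UN.IH by (auto simp only: intro!: openin_Union)
  next
    case (Basis s)
    then obtain f :: "'a \<Rightarrow> real" and U where s: "s = {P \<in> prob_measures \<Sigma>. (\<integral>\<xi>. f \<xi> \<partial>P) \<in> U}"
      "continuous_on \<Sigma> f" "open U" by blast
    have "{\<xi> \<in> UNIV \<rightarrow> \<Sigma>. empirical_measure \<Sigma> N \<xi> \<in> s} =
      (UNIV \<rightarrow> \<Sigma>) \<inter> (\<lambda>\<xi>. (\<Sum>i<N. f (\<xi> i)) / real N) -` U"
      using N by (auto simp: s(1) Pi_iff integral_empirical_measure[OF _ s(2)]
        intro!: empirical_measure_in_prob_measures)
    moreover have "continuous_on (UNIV \<rightarrow> \<Sigma>) (\<lambda>\<xi> :: nat \<Rightarrow> 'a. (\<Sum>i<N. f (\<xi> i)) / real N)"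
      using N by (intro continuous_intros continuous_on_compose2[OF s(2)]
        continuous_on_subset[OF continuous_on_product_coordinates]) auto
    ultimately show ?case using continuous_openin_preimage_gen[OF _ s(3)] by simp
  qed
qed

text \<open>On a countable power of a second countable space the product sigma-algebra contains all
  open sets; the inclusion of \<open>\<Sigma>\<close> pulls this back to sequences in
  \<open>\<Sigma>\<close>.\<close>

lemma sets_empirical_measure_PiM_UNIV:
  fixes \<Sigma> :: "'a::second_countable_topology set"
  assumes G: "openin (weak_topology \<Sigma>) G" and N: "N > 0"
  shows "{\<xi> \<in> space (PiM UNIV (\<lambda>_. borel_on \<Sigma>)). empirical_measure \<Sigma> N \<xi> \<in> G} \<in> sets (PiM UNIV (\<lambda>_. borel_on \<Sigma>))"
proof -
  obtain U where U: "open U" "{\<xi> \<in> UNIV \<rightarrow> \<Sigma>. empirical_measure \<Sigma> N \<xi> \<in> G} = (UNIV \<rightarrow> \<Sigma>) \<inter> U"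
    using openin_empirical_measure[OF G N] unfolding openin_open by blast
  have sp: "space (PiM UNIV (\<lambda>_ :: nat. borel_on \<Sigma>)) = (UNIV \<rightarrow> \<Sigma>)"
    by (auto simp: space_PiM space_restrict_space)
  have bm: "(\<lambda>x. x) \<in> measurable (borel_on \<Sigma>) borel"
    by (simp add: measurable_restrict_space1)
  have "(\<lambda>\<xi>. \<lambda>i\<in>UNIV. \<xi> i) \<in> measurable (PiM UNIV (\<lambda>_ :: nat. borel_on \<Sigma>)) (PiM UNIV (\<lambda>_. borel))"
  proof (rule measurable_restrict)
    fix i :: nat
    have "(\<lambda>\<xi>. \<xi> i) \<in> measurable (PiM UNIV (\<lambda>_ :: nat. borel_on \<Sigma>)) (borel_on \<Sigma>)"
      by (rule measurable_component_singleton) simp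
    from measurable_compose[OF this bm]
    show "(\<lambda>\<xi>. \<xi> i) \<in> measurable (PiM UNIV (\<lambda>_ :: nat. borel_on \<Sigma>)) borel" .
  qed
  moreover have "U \<in> sets (PiM UNIV (\<lambda>_ :: nat. borel :: 'a measure))"
    using U(1) by (simp add: sets_PiM_equal_borel)
  ultimately have "(\<lambda>\<xi>. \<lambda>i\<in>UNIV. \<xi> i) -` U \<inter> space (PiM UNIV (\<lambda>_ :: nat. borel_on \<Sigma>)) \<in> sets (PiM UNIV (\<lambda>_. borel_on \<Sigma>))"
    by (rule measurable_sets)
  moreover have "(\<lambda>\<xi>. \<lambda>i\<in>UNIV. \<xi> i) -` U \<inter> space (PiM UNIV (\<lambda>_ :: nat. borel_on \<Sigma>)) =
      {\<xi> \<in> space (PiM UNIV (\<lambda>_. borel_on \<Sigma>)). empirical_measure \<Sigma> N \<xi> \<in> G}"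
    using U(2) unfolding sp by (auto simp: restrict_UNIV)
  ultimately show ?thesis by simp
qed

text \<open>A finite sample is continued by a constant point of \<open>\<Sigma>\<close> to a
  sequence with the same empirical measure.\<close>

lemma sets_empirical_measure_PiM_finite:
  fixes \<Sigma> :: "'a::second_countable_topology set"
  assumes G: "openin (weak_topology \<Sigma>) G" and N: "N > 0" and ne: "\<Sigma> \<noteq> {}"
  shows "{\<xi> \<in> space (PiM {..<N} (\<lambda>_. borel_on \<Sigma>)). empirical_measure \<Sigma> N \<xi> \<in> G} \<in> sets (PiM {..<N} (\<lambda>_. borel_on \<Sigma>))"
proof -
  obtain a where a: "a \<in> \<Sigma>" using ne by blast
  define k where "k \<xi> = (\<lambda>i\<in>UNIV. if i < N then \<xi> i else a)" for \<xi> :: "nat \<Rightarrow> 'a"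
  have km: "k \<in> measurable (PiM {..<N} (\<lambda>_. borel_on \<Sigma>)) (PiM UNIV (\<lambda>_. borel_on \<Sigma>))"
    unfolding k_def
  proof (rule measurable_restrict)
    fix i :: nat
    show "(\<lambda>\<xi>. if i < N then \<xi> i else a) \<in> measurable (PiM {..<N} (\<lambda>_. borel_on \<Sigma>)) (borel_on \<Sigma>)"
      using a by (cases "i < N") (auto simp: space_restrict_space)
  qed
  have "k -` {\<xi> \<in> space (PiM UNIV (\<lambda>_. borel_on \<Sigma>)). empirical_measure \<Sigma> N \<xi> \<in> G} \<inter>
      space (PiM {..<N} (\<lambda>_. borel_on \<Sigma>)) =
      {\<xi> \<in> space (PiM {..<N} (\<lambda>_. borel_on \<Sigma>)). empirical_measure \<Sigma> N \<xi> \<in> G}"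
  proof -
    have "empirical_measure \<Sigma> N (k \<xi>) = empirical_measure \<Sigma> N \<xi>" for \<xi>
      by (rule empirical_measure_cong) (simp add: k_def)
    then show ?thesis using measurable_space[OF km] by auto
  qed
  then show ?thesis
    using measurable_sets[OF km sets_empirical_measure_PiM_UNIV[OF G N]] by simp
qed

text \<open>Feasibility refers to infinite sequences, but the change of measure lives on finite
  powers: infinite powers of two distinct laws are mutually singular. The event depends on the first
  \<open>N\<close> coordinates only, which links the two.\<close>

lemma measure_iid_samples_empirical:
  fixes \<Sigma> :: "'a::second_countable_topology set"
  assumes P: "P \<in> prob_measures \<Sigma>" and G: "openin (weak_topology \<Sigma>) G" and N: "N > 0"
  shows "measure (iid_samples P) {\<xi> \<in> space (iid_samples P). empirical_measure \<Sigma> N \<xi> \<in> G} =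
    measure (PiM {..<N} (\<lambda>_. P)) {\<xi> \<in> space (PiM {..<N} (\<lambda>_. P)). empirical_measure \<Sigma> N \<xi> \<in> G}"
proof -
  interpret P: prob_space P using prob_measuresD(1)[OF P] .
  interpret PU: product_prob_space "\<lambda>_. P" "UNIV :: nat set" by unfold_locales
  have s: "sets P = sets (borel_on \<Sigma>)" "space P = \<Sigma>" using P by (auto simp: prob_measuresD)
  have ne: "\<Sigma> \<noteq> {}" using P.not_empty s by simp
  have sS: "sets (PiM I (\<lambda>_. P)) = sets (PiM I (\<lambda>_. borel_on \<Sigma>))" for I :: "nat set"
    using s by (intro sets_PiM_cong) auto
  have m: "(\<lambda>\<xi>. restrict \<xi> {..<N}) \<in> measurable (PiM UNIV (\<lambda>_. P)) (PiM {..<N} (\<lambda>_. P))"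
    by (rule measurable_restrict_subset) simp
  let ?E = "{\<xi> \<in> space (PiM {..<N} (\<lambda>_. P)). empirical_measure \<Sigma> N \<xi> \<in> G}"
  have E: "?E \<in> sets (PiM {..<N} (\<lambda>_. P))"
    using sets_empirical_measure_PiM_finite[OF G N ne] sets_eq_imp_space_eq[OF sS] sS by simp
  have "measure (PiM {..<N} (\<lambda>_. P)) ?E =
      measure (distr (PiM UNIV (\<lambda>_. P)) (PiM {..<N} (\<lambda>_. P)) (\<lambda>\<xi>. restrict \<xi> {..<N})) ?E"
    by (subst PU.distr_PiM_restrict_finite) auto
  also have "\<dots> = measure (PiM UNIV (\<lambda>_. P)) ((\<lambda>\<xi>. restrict \<xi> {..<N}) -` ?E \<inter> space (PiM UNIV (\<lambda>_. P)))"
    by (rule measure_distr[OF m E])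
  also have "(\<lambda>\<xi>. restrict \<xi> {..<N}) -` ?E \<inter> space (PiM UNIV (\<lambda>_. P)) =
      {\<xi> \<in> space (PiM UNIV (\<lambda>_. P)). empirical_measure \<Sigma> N \<xi> \<in> G}"
  proof -
    have "empirical_measure \<Sigma> N (restrict \<xi> {..<N}) = empirical_measure \<Sigma> N \<xi>" for \<xi>
      by (rule empirical_measure_cong) simp
    then show ?thesis using measurable_space[OF m] by auto
  qed
  finally show ?thesis by (simp add: iid_samples_def)
qed

text \<open>Under the tilted law \<open>Q\<close> a typical sample has its empirical measure in
  \<open>G\<close> and an average of \<open>ln h\<close> near the divergence, hence below
  \<open>\<kappa>\<close>. Such samples eventually have probability at least 1/2, and returning to
  \<open>P\<close> costs the factor \<open>exp (- (N * \<kappa>))\<close>. The two-sided bounds on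
  \<open>h\<close> make \<open>ln h\<close> bounded, as the law of large numbers requires.\<close>

lemma Sanov_lower_bound:
  fixes \<Sigma> :: "'a::second_countable_topology set"
  assumes P: "P \<in> prob_measures \<Sigma>" and G: "openin (weak_topology \<Sigma>) G"
    and h[measurable]: "h \<in> borel_measurable P" and t: "t > 0"
    and bounds: "\<And>x. t \<le> h x" "\<And>x. h x \<le> b"
    and Q: "density P (\<lambda>x. ennreal (h x)) \<in> prob_measures \<Sigma>" "density P (\<lambda>x. ennreal (h x)) \<in> G"
    and \<kappa>: "(\<integral>x. h x * ln (h x) \<partial>P) < \<kappa>"
  shows "eventually (\<lambda>N. exp (- (real N * \<kappa>)) / 2 \<le>
    measure (iid_samples P) {\<xi> \<in> space (iid_samples P). empirical_measure \<Sigma> N \<xi> \<in> G}) sequentially"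
proof -
  define Q where "Q = density P (\<lambda>x. ennreal (h x))"
  interpret P: prob_space P using prob_measuresD(1)[OF P] .
  interpret Q: prob_space Q using prob_measuresD(1) Q(1) unfolding Q_def by blast
  have sp: "space P = \<Sigma>" "sets P = sets (borel_on \<Sigma>)" using P by (auto simp: prob_measuresD)
  have ne: "\<Sigma> \<noteq> {}" using P.not_empty sp by simp
  have sQ[measurable_cong]: "sets Q = sets P" and spQ: "space Q = \<Sigma>" using sp by (auto simp: Q_def)
  have h0: "0 < h x" for x using bounds(1)[of x] t by linarith
  let ?\<Omega> = "\<lambda>N. PiM {..<N} (\<lambda>_. Q)"
  have sS: "sets (PiM I (\<lambda>_. P)) = sets (PiM I (\<lambda>_. borel_on \<Sigma>))"
    "sets (PiM I (\<lambda>_. Q)) = sets (PiM I (\<lambda>_. P))" for I :: "nat set"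
    using sp(2) sQ by (intro sets_PiM_cong; simp)+
  note spS = sets_eq_imp_space_eq[OF sS(1)] sets_eq_imp_space_eq[OF sS(2)]
  obtain F :: "('a \<Rightarrow> real) set" and d where F: "finite F" and d: "d > 0"
    and cF: "\<And>f. f \<in> F \<Longrightarrow> continuous_on \<Sigma> f \<and> bounded (f ` \<Sigma>)"
    and nb: "\<And>R. R \<in> prob_measures \<Sigma> \<Longrightarrow> (\<And>f. f \<in> F \<Longrightarrow> \<bar>(\<integral>x. f x \<partial>R) - (\<integral>x. f x \<partial>Q)\<bar> < d) \<Longrightarrow> R \<in> G"
    using weak_topology_nbhdE[OF G Q(2)] unfolding Q_def by metis
  define bad where "bad f e N = {\<xi> \<in> space (?\<Omega> N). e \<le> \<bar>(\<Sum>i<N. f (\<xi> i)) / real N - (\<integral>x. f x \<partial>Q)\<bar>}"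
    for f :: "'a \<Rightarrow> real" and e N
  \<comment> \<open>The gap between \<open>\<kappa>\<close> and the mean of \<open>ln h\<close>
    under \<open>Q\<close>, which is the divergence of \<open>Q\<close>; a deviation smaller than
    this keeps the average below \<open>\<kappa>\<close>.\<close>
  define \<epsilon> where "\<epsilon> = \<kappa> - (\<integral>x. ln (h x) \<partial>Q)"
  have "(\<integral>x. ln (h x) \<partial>Q) = (\<integral>x. h x * ln (h x) \<partial>P)"
    unfolding Q_def using h0 by (intro integral_real_density) (auto intro: less_imp_le)
  then have \<epsilon>: "\<epsilon> > 0" using \<kappa> by (simp add: \<epsilon>_def)
  have Fm[measurable]: "f \<in> borel_measurable Q" if "f \<in> F" for f
    using continuous_on_measurable_prob_measures[OF P, of f] cF[OF that] sQ
    by (simp cong: measurable_cong_sets)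
  have lim_f: "(\<lambda>N. measure (?\<Omega> N) (bad f d N)) \<longlonglongrightarrow> 0" if f: "f \<in> F" for f
  proof -
    obtain B where "\<forall>x\<in>\<Sigma>. \<bar>f x\<bar> \<le> B" using cF[OF f] unfolding bounded_iff by auto
    then show ?thesis unfolding bad_def using d Fm[OF f] spQ by (intro Q.weak_law_PiM) auto
  qed
  have lim_h: "(\<lambda>N. measure (?\<Omega> N) (bad (\<lambda>x. ln (h x)) \<epsilon> N)) \<longlonglongrightarrow> 0"
    unfolding bad_def
  proof (rule Q.weak_law_PiM[OF _ _ \<epsilon>])
    fix x
    have "ln t \<le> ln (h x)" "ln (h x) \<le> ln b"
      using bounds[of x] t h0[of x] by auto
    then show "\<bar>ln (h x)\<bar> \<le> \<bar>ln t\<bar> + \<bar>ln b\<bar>" by linarith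
  qed measurable
  have "(\<lambda>N. (\<Sum>f\<in>F. measure (?\<Omega> N) (bad f d N)) + measure (?\<Omega> N) (bad (\<lambda>x. ln (h x)) \<epsilon> N)) \<longlonglongrightarrow> (\<Sum>f\<in>F. 0) + 0"
    by (intro tendsto_add tendsto_sum lim_f lim_h)
  \<comment> \<open>Any constant below 1 would serve: its logarithm disappears after division by the
    sample size.\<close>
  then have "eventually (\<lambda>N. (\<Sum>f\<in>F. measure (?\<Omega> N) (bad f d N)) + measure (?\<Omega> N) (bad (\<lambda>x. ln (h x)) \<epsilon> N) < 1 / 2) sequentially"
    by (intro order_tendstoD) auto
  then show ?thesis
    using eventually_gt_at_top[of 0]
  proof eventually_elim
    case (elim N)
    interpret PQ: product_prob_space "\<lambda>_. Q" "{..<N}" by unfold_locales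
    let ?E = "{\<xi> \<in> space (PiM {..<N} (\<lambda>_. P)). empirical_measure \<Sigma> N \<xi> \<in> G}"
    let ?V = "{\<xi> \<in> ?E. (\<Sum>i<N. ln (h (\<xi> i))) \<le> real N * \<kappa>}"
    have E[measurable]: "?E \<in> sets (PiM {..<N} (\<lambda>_. P))"
      using sets_empirical_measure_PiM_finite[OF G elim(2) ne] spS sS by simp
    have Ei: "?E \<in> sets (?\<Omega> N)" using E sS by simp
    have "{\<xi> \<in> space (?\<Omega> N). (\<Sum>i<N. ln (h (\<xi> i))) \<le> real N * \<kappa>} \<in> sets (?\<Omega> N)"
      by measurable
    moreover have "?V = ?E \<inter> {\<xi> \<in> space (?\<Omega> N). (\<Sum>i<N. ln (h (\<xi> i))) \<le> real N * \<kappa>}"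
      using spS by auto
    ultimately have V: "?V \<in> sets (?\<Omega> N)" using Ei by simp
    have badm: "bad f e N \<in> sets (?\<Omega> N)" if [measurable]: "f \<in> borel_measurable Q" for f e
      unfolding bad_def by measurable
    have hm: "(\<lambda>x. ln (h x)) \<in> borel_measurable Q" by measurable
    have badF: "(\<Union>f\<in>F. bad f d N) \<in> sets (?\<Omega> N)"
      using F badm Fm by (intro sets.finite_UN) auto
    \<comment> \<open>A sample outside all bad events satisfies both conditions of
      \<open>?V\<close>: the deviations for \<open>F\<close> put its empirical measure into
      \<open>G\<close>, the one for \<open>ln h\<close> bounds the log-likelihood ratio.\<close>
    have "space (?\<Omega> N) - ?V \<subseteq> (\<Union>f\<in>F. bad f d N) \<union> bad (\<lambda>x. ln (h x)) \<epsilon> N"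
    proof
      fix \<xi> assume xi: "\<xi> \<in> space (?\<Omega> N) - ?V"
      then have xS: "\<xi> i \<in> \<Sigma>" if "i < N" for i
        using that spQ by (auto simp: space_PiM)
      show "\<xi> \<in> (\<Union>f\<in>F. bad f d N) \<union> bad (\<lambda>x. ln (h x)) \<epsilon> N"
      proof (rule ccontr)
        assume nb': "\<not> ?thesis"
        have "empirical_measure \<Sigma> N \<xi> \<in> G"
        proof (rule nb)
          show "empirical_measure \<Sigma> N \<xi> \<in> prob_measures \<Sigma>"
            using elim(2) xS by (rule empirical_measure_in_prob_measures)
          fix f assume "f \<in> F"
          then have "continuous_on \<Sigma> f" "\<xi> \<notin> bad f d N" using cF nb' by auto
          then show "\<bar>(\<integral>x. f x \<partial>empirical_measure \<Sigma> N \<xi>) - (\<integral>x. f x \<partial>Q)\<bar> < d"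
            using xi xS by (auto simp: bad_def integral_empirical_measure)
        qed
        moreover have "(\<Sum>i<N. ln (h (\<xi> i))) \<le> real N * \<kappa>"
        proof -
          have "\<xi> \<notin> bad (\<lambda>x. ln (h x)) \<epsilon> N" using nb' by auto
          then have "(\<Sum>i<N. ln (h (\<xi> i))) / real N < \<kappa>"
            using xi by (auto simp: bad_def \<epsilon>_def)
          then show ?thesis using elim(2) by (simp add: divide_simps mult.commute split: if_splits)
        qed
        ultimately show False using xi spS by auto
      qed
    qed
    then have "measure (?\<Omega> N) (space (?\<Omega> N) - ?V) \<le> measure (?\<Omega> N) ((\<Union>f\<in>F. bad f d N) \<union> bad (\<lambda>x. ln (h x)) \<epsilon> N)"
      using badm[OF hm] badF by (intro PQ.P.finite_measure_mono) auto
    also have "\<dots> \<le> measure (?\<Omega> N) (\<Union>f\<in>F. bad f d N) + measure (?\<Omega> N) (bad (\<lambda>x. ln (h x)) \<epsilon> N)"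
      using badm[OF hm] badF by (intro measure_Un_le) auto
    also have "measure (?\<Omega> N) (\<Union>f\<in>F. bad f d N) \<le> (\<Sum>f\<in>F. measure (?\<Omega> N) (bad f d N))"
      using badm Fm F by (intro PQ.P.finite_measure_subadditive_finite) auto
    finally have "measure (?\<Omega> N) (space (?\<Omega> N) - ?V) < 1 / 2" using elim(1) by linarith
    then have half: "1 / 2 \<le> measure (?\<Omega> N) ?V"
      using PQ.P.prob_compl[OF V] by linarith
    have "exp (- (real N * \<kappa>)) / 2 \<le> exp (- (real N * \<kappa>)) * measure (?\<Omega> N) ?V"
      using half by (simp add: mult_left_mono)
    also have "\<dots> \<le> measure (PiM {..<N} (\<lambda>_. P)) ?E"
      unfolding Q_def using h0 E Q.prob_space_axioms unfolding Q_def
      by (intro P.change_of_measure_PiM) auto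
    also have "\<dots> = measure (iid_samples P) {\<xi> \<in> space (iid_samples P). empirical_measure \<Sigma> N \<xi> \<in> G}"
      by (rule measure_iid_samples_empirical[OF P G elim(2), symmetric])
    finally show ?case .
  qed
qed

section \<open>Separation from the ambiguity set\<close>

text \<open>Convexity of \<open>x * ln x\<close> between \<open>x\<close> and 1, where the function
  vanishes. The value 1 is the density of \<open>P\<close> with respect to itself, so mixing
  \<open>P\<close> in with weight \<open>t\<close> scales the divergence by at most
  \<open>1 - t\<close>.\<close>

lemma mult_ln_convex_comb_le:
  assumes "0 \<le> (x::real)" "0 < t" "t \<le> 1"
  shows "((1 - t) * x + t) * ln ((1 - t) * x + t) \<le> (1 - t) * (x * ln x)"
proof -
  define q where "q = (1 - t) * x + t"
  have q: "q > 0" unfolding q_def using assms by (intro add_nonneg_pos mult_nonneg_nonneg) auto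
  \<comment> \<open>The tangent of \<open>y * ln y\<close> at \<open>q\<close> lies below the graph;
    \<open>y = 0\<close> is covered by the convention that the product is 0.\<close>
  have tangent: "y * ln q + (y - q) \<le> y * ln y" if "y \<ge> 0" for y
  proof (cases "y = 0")
    case False
    then have y: "y > 0" using that by simp
    have "ln (q / y) \<le> q / y - 1" using q y by (intro ln_le_minus_one) auto
    then have "y * ln (q / y) \<le> y * (q / y - 1)" using y by (intro mult_left_mono) auto
    then show ?thesis using q y by (simp add: ln_div right_diff_distrib)
  qed (use q in simp)
  have "q * ln q = (1 - t) * (x * ln q + (x - q)) + t * (1 * ln q + (1 - q))"
    unfolding q_def by (simp add: algebra_simps)
  also have "\<dots> \<le> (1 - t) * (x * ln x) + t * (1 * ln 1)"
    using assms by (intro add_mono mult_left_mono tangent) auto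
  finally show ?thesis by (simp add: q_def)
qed

text \<open>Mixing a little of \<open>P\<close> into \<open>P'\<close> makes the divergence strictly smaller than \<open>r\<close> and bounds the
  density away from 0; truncating the density afterwards bounds it from above.\<close>

lemma bounded_density_approximation:
  fixes P P' :: "'a::topological_space measure" and r :: real
  assumes P: "P \<in> prob_measures \<Sigma>" and P': "P' \<in> prob_measures \<Sigma>" and KL: "KL P' P \<le> ereal r" and r: "r > 0"
    and G: "openin (weak_topology \<Sigma>) G" "P' \<in> G"
  obtains h t b where "h \<in> borel_measurable P" "t > 0" "\<And>x. t \<le> h x" "\<And>x. h x \<le> b"
    "density P (\<lambda>x. ennreal (h x)) \<in> prob_measures \<Sigma>" "density P (\<lambda>x. ennreal (h x)) \<in> G"
    "(\<integral>x. h x * ln (h x) \<partial>P) < r"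
proof -
  interpret P: prob_space P using prob_measuresD(1)[OF P] .
  obtain k where k[measurable]: "k \<in> borel_measurable P" and k0: "\<And>x. 0 \<le> k x"
    and P'k: "P' = density P (\<lambda>x. ennreal (k x))"
    and ikl: "integrable P (\<lambda>x. k x * ln (k x))" and kl: "(\<integral>x. k x * ln (k x) \<partial>P) \<le> r"
    using KL_leE[OF P P' KL] by blast
  interpret P': prob_space P' using prob_measuresD(1)[OF P'] .
  have ik: "integrable P k" and k1: "(\<integral>x. k x \<partial>P) = 1"
  proof -
    have "integrable P' (\<lambda>x. 1 :: real)" by simp
    then show "integrable P k" using k0 unfolding P'k by (subst (asm) integrable_real_density) auto
    have "(\<integral>x. 1 \<partial>P') = (1::real)" using P'.prob_space by simp
    then show "(\<integral>x. k x \<partial>P) = 1" using k0 unfolding P'k by (subst (asm) integral_real_density) auto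
  qed
  obtain F :: "('a \<Rightarrow> real) set" and d where F: "finite F" and d: "d > 0"
    and cF: "\<And>f. f \<in> F \<Longrightarrow> continuous_on \<Sigma> f \<and> bounded (f ` \<Sigma>)"
    and nb: "\<And>R. R \<in> prob_measures \<Sigma> \<Longrightarrow> (\<And>f. f \<in> F \<Longrightarrow> \<bar>(\<integral>x. f x \<partial>R) - (\<integral>x. f x \<partial>P')\<bar> < d) \<Longrightarrow> R \<in> G"
    using weak_topology_nbhdE[OF G] by metis
  have iP: "integrable P f" if "f \<in> F" for f
    using integrable_continuous_prob_measures[OF P] cF[OF that] by blast
  have fkP: "integrable P (\<lambda>x. k x * f x)" "(\<integral>x. f x \<partial>P') = (\<integral>x. k x * f x \<partial>P)" if "f \<in> F" for f
  proof -
    have "integrable P' f" using integrable_continuous_prob_measures[OF P'] cF[OF that] by blast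
    then show "integrable P (\<lambda>x. k x * f x)"
      using k0 iP[OF that] unfolding P'k by (subst (asm) integrable_real_density) auto
    show "(\<integral>x. f x \<partial>P') = (\<integral>x. k x * f x \<partial>P)"
      using k0 iP[OF that] unfolding P'k by (intro integral_real_density) auto
  qed
  define K where "K = (\<Sum>f\<in>F. \<bar>(\<integral>x. f x \<partial>P) - (\<integral>x. f x \<partial>P')\<bar>) + 1"
  have K: "K > 0" unfolding K_def by (intro add_nonneg_pos sum_nonneg) auto
  \<comment> \<open>\<open>K\<close> dominates the change of every test integral between
    \<open>P'\<close> and \<open>P\<close>, so a weight with \<open>t * K \<le> d / 2\<close> keeps
    the mixture in the neighbourhood; the cap 1/2 keeps it a proper mixture.\<close>
  define t where "t = min (1 / 2) (d / (2 * K))"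
  have t: "0 < t" "t \<le> 1 / 2" "t * K \<le> d / 2"
  proof -
    show "0 < t" "t \<le> 1 / 2" using d K by (auto simp: t_def)
    have "t * K \<le> d / (2 * K) * K" using K by (intro mult_right_mono) (auto simp: t_def)
    then show "t * K \<le> d / 2" using K by simp
  qed
  define q where "q x = (1 - t) * k x + t" for x
  have [measurable]: "q \<in> borel_measurable P" unfolding q_def by measurable
  have qt: "t \<le> q x" for x using k0[of x] t by (simp add: q_def)
  have q0: "0 < q x" for x using qt[of x] t by linarith
  have iq: "integrable P q" and q1: "(\<integral>x. q x \<partial>P) = 1"
    using ik k1 unfolding q_def by (auto simp: P.prob_space)
  have qlq: "q x * ln (q x) \<le> (1 - t) * (k x * ln (k x))" for x
    unfolding q_def using k0 t by (intro mult_ln_convex_comb_le) auto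
  have iql: "integrable P (\<lambda>x. q x * ln (q x))"
  proof (rule Bochner_Integration.integrable_bound[of P "\<lambda>x. \<bar>(1 - t) * (k x * ln (k x))\<bar> + 1"])
    show "AE x in P. norm (q x * ln (q x)) \<le> norm (\<bar>(1 - t) * (k x * ln (k x))\<bar> + 1)"
    proof (rule AE_I2)
      fix x
      have "-1 \<le> q x * ln (q x)" using q0[of x] by (intro mult_ln_ge_minus_one) simp
      then show "norm (q x * ln (q x)) \<le> norm (\<bar>(1 - t) * (k x * ln (k x))\<bar> + 1)"
        using qlq[of x] by (simp only: real_norm_def)
    qed
  qed (use ikl in auto)
  have "(\<integral>x. q x * ln (q x) \<partial>P) \<le> (\<integral>x. (1 - t) * (k x * ln (k x)) \<partial>P)"
    using iql ikl qlq by (intro integral_mono) auto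
  also have "\<dots> = (1 - t) * (\<integral>x. k x * ln (k x) \<partial>P)" by simp
  also have "\<dots> \<le> (1 - t) * r" using kl t by (intro mult_left_mono) auto
  also have "\<dots> < r" using t r by (simp add: left_diff_distrib)
  finally have qr: "(\<integral>x. q x * ln (q x) \<partial>P) < r" .
  have qf: "integrable P (\<lambda>x. q x * f x)" "\<bar>(\<integral>x. q x * f x \<partial>P) - (\<integral>x. f x \<partial>P')\<bar> < d" if f: "f \<in> F" for f
  proof -
    have eq: "q x * f x = (1 - t) * (k x * f x) + t * f x" for x by (simp add: q_def algebra_simps)
    show "integrable P (\<lambda>x. q x * f x)" unfolding eq using fkP(1)[OF f] iP[OF f] by auto
    have "(\<integral>x. q x * f x \<partial>P) - (\<integral>x. f x \<partial>P') = t * ((\<integral>x. f x \<partial>P) - (\<integral>x. f x \<partial>P'))"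
      unfolding eq using fkP[OF f] iP[OF f] by (simp add: algebra_simps)
    then have "\<bar>(\<integral>x. q x * f x \<partial>P) - (\<integral>x. f x \<partial>P')\<bar> = t * \<bar>(\<integral>x. f x \<partial>P) - (\<integral>x. f x \<partial>P')\<bar>"
      using t by (simp add: abs_mult)
    also have "\<dots> \<le> t * K"
    proof -
      have "\<bar>(\<integral>x. f x \<partial>P) - (\<integral>x. f x \<partial>P')\<bar> \<le> (\<Sum>f\<in>F. \<bar>(\<integral>x. f x \<partial>P) - (\<integral>x. f x \<partial>P')\<bar>)"
        using F f by (intro member_le_sum) auto
      then show ?thesis using t by (intro mult_left_mono) (auto simp: K_def)
    qed
    finally show "\<bar>(\<integral>x. q x * f x \<partial>P) - (\<integral>x. f x \<partial>P')\<bar> < d" using t(3) d by linarith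
  qed
  define g where "g n x = min (q x) (real (Suc n))" for n x
  have [measurable]: "g n \<in> borel_measurable P" for n unfolding g_def by measurable
  have gt: "t \<le> g n x" for n x using qt[of x] t by (auto simp: g_def)
  have g0: "0 < g n x" for n x using gt[of n x] t by linarith
  have gq: "g n x \<le> q x" for n x by (simp add: g_def)
  have ig: "integrable P (g n)" for n
    using iq by (rule Bochner_Integration.integrable_bound) (use gq g0 in \<open>auto simp: abs_of_pos q0 less_imp_le\<close>)
  have lim_g: "(\<lambda>n. g n x) \<longlonglongrightarrow> q x" for x
  proof -
    obtain m where m: "q x < real m" using reals_Archimedean2 by blast
    show ?thesis
      using m by (intro tendsto_eventually eventually_sequentiallyI[of m]) (auto simp: g_def)
  qed
  \<comment> \<open>Truncation takes place at a level of at least 1, and beyond 1 the function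
    \<open>x * ln x\<close> is nonnegative and increasing. This provides the dominating function for
    the limit.\<close>
  have gl: "\<bar>g n x * ln (g n x)\<bar> \<le> \<bar>q x * ln (q x)\<bar>" for n x
  proof (cases "q x \<le> real (Suc n)")
    case False
    have "real (Suc n) * ln (real (Suc n)) \<le> q x * ln (q x)"
      using False q0[of x] by (intro mult_mono) auto
    moreover have "0 \<le> real (Suc n) * ln (real (Suc n))" by simp
    ultimately show ?thesis using False by (simp add: g_def)
  qed (simp add: g_def)
  define Z where "Z n = (\<integral>x. g n x \<partial>P)" for n
  have Zt: "t \<le> Z n" for n unfolding Z_def using gt ig by (intro P.integral_ge_const) auto
  have Z0: "0 < Z n" for n using Zt[of n] t by linarith
  have Z1: "Z n \<le> 1" for n
    unfolding Z_def q1[symmetric] using ig iq gq by (intro integral_mono) auto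
  have lim_Z: "Z \<longlonglongrightarrow> 1"
    unfolding Z_def q1[symmetric] using iq lim_g gq g0
    by (intro integral_dominated_convergence[where w = q]) (auto simp: abs_of_pos less_imp_le)
  have lim_f: "(\<lambda>n. (\<integral>x. g n x * f x \<partial>P) / Z n) \<longlonglongrightarrow> (\<integral>x. q x * f x \<partial>P) / 1" if f: "f \<in> F" for f
  proof (intro tendsto_divide lim_Z)
    show "(\<lambda>n. \<integral>x. g n x * f x \<partial>P) \<longlonglongrightarrow> (\<integral>x. q x * f x \<partial>P)"
    proof (rule integral_dominated_convergence[where w = "\<lambda>x. \<bar>q x * f x\<bar>"])
      show "AE x in P. (\<lambda>n. g n x * f x) \<longlonglongrightarrow> q x * f x"
        by (intro AE_I2 tendsto_mult lim_g tendsto_const)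
      show "AE x in P. norm (g n x * f x) \<le> \<bar>q x * f x\<bar>" for n
        using gq g0 q0 by (intro AE_I2) (auto simp: abs_mult abs_of_pos intro!: mult_right_mono)
    qed (use qf(1)[OF f] iP[OF f] in auto)
  qed simp
  \<comment> \<open>The expression is the entropy integral of the normalised density
    \<open>g n x / Z n\<close>, computed in advance; its limit is that of \<open>q\<close> because
    \<open>Z\<close> tends to 1.\<close>
  have lim_l: "(\<lambda>n. (\<integral>x. g n x * ln (g n x) \<partial>P) / Z n - ln (Z n)) \<longlonglongrightarrow> (\<integral>x. q x * ln (q x) \<partial>P) / 1 - ln 1"
  proof (intro tendsto_diff tendsto_divide lim_Z tendsto_ln)
    show "(\<lambda>n. \<integral>x. g n x * ln (g n x) \<partial>P) \<longlonglongrightarrow> (\<integral>x. q x * ln (q x) \<partial>P)"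
    proof (rule integral_dominated_convergence[where w = "\<lambda>x. \<bar>q x * ln (q x)\<bar>"])
      show "AE x in P. (\<lambda>n. g n x * ln (g n x)) \<longlonglongrightarrow> q x * ln (q x)"
        using q0 by (intro AE_I2 tendsto_mult lim_g tendsto_ln) (auto simp: less_imp_neq[symmetric])
    qed (use gl iql in auto)
  qed simp_all
  have "eventually (\<lambda>n. \<forall>f\<in>F. \<bar>(\<integral>x. g n x * f x \<partial>P) / Z n - (\<integral>x. f x \<partial>P')\<bar> < d) sequentially"
  proof (rule eventually_ball_finite[OF F], rule ballI)
    fix f assume f: "f \<in> F"
    have "(\<lambda>n. \<bar>(\<integral>x. g n x * f x \<partial>P) / Z n - (\<integral>x. f x \<partial>P')\<bar>) \<longlonglongrightarrow>
        \<bar>(\<integral>x. q x * f x \<partial>P) / 1 - (\<integral>x. f x \<partial>P')\<bar>"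
      by (intro tendsto_rabs tendsto_diff lim_f[OF f] tendsto_const)
    then show "eventually (\<lambda>n. \<bar>(\<integral>x. g n x * f x \<partial>P) / Z n - (\<integral>x. f x \<partial>P')\<bar> < d) sequentially"
      using qf(2)[OF f] by (intro order_tendstoD(2)) auto
  qed
  moreover have "eventually (\<lambda>n. (\<integral>x. g n x * ln (g n x) \<partial>P) / Z n - ln (Z n) < r) sequentially"
    using qr by (intro order_tendstoD(2)[OF lim_l]) simp
  ultimately have "eventually (\<lambda>n. (\<forall>f\<in>F. \<bar>(\<integral>x. g n x * f x \<partial>P) / Z n - (\<integral>x. f x \<partial>P')\<bar> < d) \<and>
      (\<integral>x. g n x * ln (g n x) \<partial>P) / Z n - ln (Z n) < r) sequentially"
    by (rule eventually_conj)
  then obtain n where n: "\<And>f. f \<in> F \<Longrightarrow> \<bar>(\<integral>x. g n x * f x \<partial>P) / Z n - (\<integral>x. f x \<partial>P')\<bar> < d"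
    "(\<integral>x. g n x * ln (g n x) \<partial>P) / Z n - ln (Z n) < r"
    by (auto simp: eventually_sequentially)
  define h where "h x = g n x / Z n" for x
  have hm[measurable]: "h \<in> borel_measurable P" unfolding h_def by measurable
  \<comment> \<open>Since truncation only removes mass, \<open>Z n \<le> 1\<close>, and normalising
    preserves the lower bound \<open>t\<close>.\<close>
  have ht: "t \<le> h x" for x
  proof -
    have "g n x * Z n \<le> g n x * 1" using Z1[of n] g0[of n x] by (intro mult_left_mono) auto
    then have "g n x \<le> h x" using Z0[of n] by (simp add: h_def field_simps)
    then show ?thesis using gt[of n x] by linarith
  qed
  have h0: "0 < h x" for x using ht[of x] t by linarith
  have hb: "h x \<le> real (Suc n) / Z n" for x
    unfolding h_def using Z0[of n] by (intro divide_right_mono) (auto simp: g_def)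
  have h1: "(\<integral>x. h x \<partial>P) = 1" and ih: "integrable P h"
    unfolding h_def using Z0[of n] ig[of n] by (auto simp: Z_def)
  have Q: "density P (\<lambda>x. ennreal (h x)) \<in> prob_measures \<Sigma>"
  proof -
    have "emeasure (density P (\<lambda>x. ennreal (h x))) (space P) = (\<integral>\<^sup>+x. ennreal (h x) \<partial>P)"
      by (subst emeasure_density) (auto intro!: nn_integral_cong)
    also have "\<dots> = 1"
      using h0 ih h1 by (subst nn_integral_eq_integral) (auto simp: less_imp_le)
    finally have "prob_space (density P (\<lambda>x. ennreal (h x)))" by (intro prob_spaceI) simp
    then show ?thesis using prob_measuresD(2)[OF P] by (simp add: prob_measures_def)
  qed
  have QG: "density P (\<lambda>x. ennreal (h x)) \<in> G"
  proof (rule nb[OF Q])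
    fix f assume f: "f \<in> F"
    have "(\<integral>x. f x \<partial>density P (\<lambda>x. ennreal (h x))) = (\<integral>x. h x * f x \<partial>P)"
      using h0 iP[OF f] by (intro integral_real_density) (auto simp: less_imp_le)
    also have "\<dots> = (\<integral>x. g n x * f x \<partial>P) / Z n" by (simp add: h_def)
    finally show "\<bar>(\<integral>x. f x \<partial>density P (\<lambda>x. ennreal (h x))) - (\<integral>x. f x \<partial>P')\<bar> < d"
      using n(1)[OF f] by simp
  qed
  have igl: "integrable P (\<lambda>x. g n x * ln (g n x))"
    using iql by (rule Bochner_Integration.integrable_bound) (use gl in auto)
  have "(\<integral>x. h x * ln (h x) \<partial>P) = (\<integral>x. g n x * ln (g n x) / Z n - ln (Z n) / Z n * g n x \<partial>P)"
  proof (intro Bochner_Integration.integral_cong refl)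
    fix x
    have "ln (h x) = ln (g n x) - ln (Z n)" unfolding h_def using g0[of n x] Z0[of n] by (simp add: ln_div)
    then show "h x * ln (h x) = g n x * ln (g n x) / Z n - ln (Z n) / Z n * g n x"
      by (simp add: h_def right_diff_distrib diff_divide_distrib)
  qed
  also have "\<dots> = (\<integral>x. g n x * ln (g n x) \<partial>P) / Z n - ln (Z n) / Z n * Z n"
    using igl ig[of n] by (simp add: Z_def)
  also have "\<dots> < r" using n(2) Z0[of n] by simp
  finally have "(\<integral>x. h x * ln (h x) \<partial>P) < r" .
  then show ?thesis using that[OF hm t(1) ht hb Q QG] by blast
qed

lemma KL_ball_subset_ambiguity_set:
  fixes X :: "'x set" and \<Sigma> :: "'a::second_countable_topology set" and r :: real
  assumes X: "X \<noteq> {}" and r: "r > 0"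
    and L: "loss_class X \<Sigma> L" and DRO: "DRO_predictor X \<Sigma> L \<A> c"
    and feasible: "reasonably_feasible X \<Sigma> r c"
    and P': "P' \<in> prob_measures \<Sigma>" and P: "P \<in> prob_measures \<Sigma>" and KL: "KL P' P \<le> ereal r"
  shows "P \<in> \<A> P'"
proof (rule ccontr)
  assume notin: "P \<notin> \<A> P'"
  have A: "\<A> P' \<noteq> {}" "\<A> P' \<subseteq> prob_measures \<Sigma>" "closedin (weak_topology \<Sigma>) (\<A> P')" "convex_measures (\<A> P')"
    using DRO P' by (auto simp: DRO_predictor_def)
  obtain f :: "'a \<Rightarrow> real" and m where f: "continuous_on \<Sigma> f" "bounded (f ` \<Sigma>)" "m > 0" "\<And>Q. Q \<in> \<A> P' \<Longrightarrow> (\<integral>x. f x \<partial>Q) + m \<le> (\<integral>x. f x \<partial>P)"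
    by (rule weak_separation[OF A(4,2,1,3) P notin]) (rule that)
  \<comment> \<open>The separating function is used as a loss that ignores the decision, so the
    event of disappointment is the same for every decision in \<open>X\<close>.\<close>
  define l :: "'x \<Rightarrow> 'a \<Rightarrow> real" where "l x \<xi> = f \<xi>" for x \<xi>
  have ldf: "l \<in> decision_free X \<Sigma>" using f(1) by (auto simp: decision_free_def l_def)
  then have lL: "l \<in> L" using L by (auto simp: loss_class_def)
  have cost: "cost l x R = (\<integral>\<xi>. f \<xi> \<partial>R)" for x R by (simp add: cost_def l_def)
  have c: "c l x R = (SUP Q\<in>\<A> R. ereal (\<integral>\<xi>. f \<xi> \<partial>Q))" if "x \<in> X" "R \<in> prob_measures \<Sigma>" for x R
  proof -
    have "c l x R = (SUP Q\<in>\<A> R. ereal (cost l x Q))"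
      using DRO lL that unfolding DRO_predictor_def by blast
    then show ?thesis by (simp add: cost)
  qed
  obtain x0 where x0: "x0 \<in> X" using X by blast
  \<comment> \<open>A strict sublevel set of the predictor, at the true cost under \<open>P\<close>;
    upper semicontinuity says precisely that it is open. The separation margin \<open>m\<close> puts
    \<open>P'\<close> into it even after the supremum over the ambiguity set.\<close>
  define G where "G = {R \<in> prob_measures \<Sigma>. c l x0 R < ereal (\<integral>\<xi>. f \<xi> \<partial>P)}"
  have G: "openin (weak_topology \<Sigma>) G"
    using DRO lL x0 by (auto simp: DRO_predictor_def upper_semicontinuous_map_def G_def)
  have P'G: "P' \<in> G"
  proof -
    have "c l x0 P' \<le> ereal ((\<integral>x. f x \<partial>P) - m)"
      unfolding c[OF x0 P'] using f(4) by (intro SUP_least) (simp add: le_diff_eq)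
    also have "\<dots> < ereal (\<integral>x. f x \<partial>P)" using f(3) by simp
    finally show ?thesis using P' by (simp add: G_def)
  qed
  obtain h t b where h: "h \<in> borel_measurable P" "t > 0" "\<And>x. t \<le> h x" "\<And>x. h x \<le> b"
    "density P (\<lambda>x. ennreal (h x)) \<in> prob_measures \<Sigma>" "density P (\<lambda>x. ennreal (h x)) \<in> G"
    "(\<integral>x. h x * ln (h x) \<partial>P) < r"
    by (rule bounded_density_approximation[OF P P' KL r G P'G]) (rule that)
  \<comment> \<open>Two intermediate rates are used: \<open>\<kappa>\<close> for the exponential
    bound, and \<open>\<kappa>'\<close> to absorb the factor 1/2, since
    \<open>ln 2 < N * (\<kappa>' - \<kappa>)\<close> for large \<open>N\<close>.\<close>
  obtain \<kappa> where \<kappa>: "(\<integral>x. h x * ln (h x) \<partial>P) < \<kappa>" "\<kappa> < r" using dense[OF h(7)] by blast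
  obtain \<kappa>' where \<kappa>': "\<kappa> < \<kappa>'" "\<kappa>' < r" using dense[OF \<kappa>(2)] by blast
  define p where "p N = measure (iid_samples P) {\<xi> \<in> space (iid_samples P).
      \<exists>x\<in>X. ereal (cost l x P) > c l x (empirical_measure \<Sigma> N \<xi>)}" for N
  have "eventually (\<lambda>N. exp (- (real N * \<kappa>)) / 2 \<le>
    measure (iid_samples P) {\<xi> \<in> space (iid_samples P). empirical_measure \<Sigma> N \<xi> \<in> G}) sequentially"
    by (rule Sanov_lower_bound[OF P G h(1-6) \<kappa>(1)])
  moreover have "eventually (\<lambda>N. ln 2 / (\<kappa>' - \<kappa>) < real N) sequentially"
  proof -
    obtain j where "ln 2 / (\<kappa>' - \<kappa>) < real j" using reals_Archimedean2 by blast
    then show ?thesis by (intro eventually_sequentiallyI[of j]) auto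
  qed
  ultimately have "eventually (\<lambda>N. ereal (- \<kappa>') \<le> ereal (1 / real N) * log_prob (p N)) sequentially"
    using eventually_gt_at_top[of 0]
  proof eventually_elim
    case (elim N)
    \<comment> \<open>The event of disappointment is exactly that the empirical measure lies in
      \<open>G\<close>, which is measurable. Positive \<open>N\<close> ensures that the empirical
      measure is a probability measure, where the formula for the predictor holds.\<close>
    have "{\<xi> \<in> space (iid_samples P). \<exists>x\<in>X. ereal (cost l x P) > c l x (empirical_measure \<Sigma> N \<xi>)} =
        {\<xi> \<in> space (iid_samples P). empirical_measure \<Sigma> N \<xi> \<in> G}"
    proof (intro Collect_cong conj_cong refl)
      fix \<xi> assume "\<xi> \<in> space (iid_samples P)"
      then have "\<xi> i \<in> \<Sigma>" for i
        using prob_measuresD(3)[OF P] by (auto simp: iid_samples_def space_PiM)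
      then have "empirical_measure \<Sigma> N \<xi> \<in> prob_measures \<Sigma>"
        using elim(3) by (intro empirical_measure_in_prob_measures) auto
      then show "(\<exists>x\<in>X. ereal (cost l x P) > c l x (empirical_measure \<Sigma> N \<xi>)) \<longleftrightarrow> empirical_measure \<Sigma> N \<xi> \<in> G"
        using x0 by (auto simp: G_def cost c)
    qed
    then have p: "exp (- (real N * \<kappa>)) / 2 \<le> p N" using elim(1) by (simp add: p_def)
    then have p0: "p N > 0" using exp_gt_zero[of "- (real N * \<kappa>)"] by linarith
    have "- (real N * \<kappa>) - ln 2 = ln (exp (- (real N * \<kappa>)) / 2)" by (simp add: ln_div)
    also have "\<dots> \<le> ln (p N)" using p p0 by (subst ln_le_cancel_iff) auto
    finally have "- (real N * \<kappa>) - ln 2 \<le> ln (p N)" .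
    moreover have "ln 2 < real N * (\<kappa>' - \<kappa>)" using elim(2) \<kappa>'(1) by (simp add: pos_divide_less_eq)
    ultimately have "real N * (- \<kappa>') \<le> ln (p N)" by (simp add: right_diff_distrib)
    then have "- \<kappa>' \<le> 1 / real N * ln (p N)" using elim(3) by (simp add: field_simps)
    then show ?case using p0 by (simp add: log_prob_def)
  qed
  then have "ereal (- \<kappa>') \<le> liminf (\<lambda>N. ereal (1 / real N) * log_prob (p N))"
    by (rule Liminf_bounded)
  also have "\<dots> \<le> limsup (\<lambda>N. ereal (1 / real N) * log_prob (p N))"
    by (rule Liminf_le_Limsup) simp
  also have "\<dots> \<le> - ereal r"
    using feasible ldf P unfolding reasonably_feasible_def p_def by (auto simp: SUP_le_iff)
  finally show False using \<kappa>'(2) by simp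
qed

theorem theorem5p5:
  fixes X :: "'x::euclidean_space set"
    and \<Sigma> :: "'a::euclidean_space set"
    and r :: real
    and L :: "('x \<Rightarrow> 'a \<Rightarrow> real) set"
    and \<A> :: "'a measure \<Rightarrow> 'a measure set"
    and c :: "('x \<Rightarrow> 'a \<Rightarrow> real) \<Rightarrow> 'x \<Rightarrow> 'a measure \<Rightarrow> ereal"
    and P' :: "'a measure"
  assumes "X \<noteq> {}"
    and "compact \<Sigma>"
    and "r > 0"
    and "loss_class X \<Sigma> L"
    and "DRO_predictor X \<Sigma> L \<A> c"
    and "reasonably_feasible X \<Sigma> r c"
    and "P' \<in> prob_measures \<Sigma>"
  shows "(\<Inter>\<epsilon>\<in>{0<..}. {P \<in> prob_measures \<Sigma>. KL_W \<Sigma> \<epsilon> P' P \<le> ereal r}) =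
           (\<Inter>\<epsilon>\<in>{0<..}. {P \<in> prob_measures \<Sigma>. KL_LP \<Sigma> \<epsilon> P' P \<le> ereal r}) \<and>
         (\<Inter>\<epsilon>\<in>{0<..}. {P \<in> prob_measures \<Sigma>. KL_LP \<Sigma> \<epsilon> P' P \<le> ereal r}) =
           {P \<in> prob_measures \<Sigma>. KL P' P \<le> ereal r} \<and>
         {P \<in> prob_measures \<Sigma>. KL P' P \<le> ereal r} \<subseteq> \<A> P'"
proof -
  have \<Sigma>: "\<Sigma> \<in> sets borel" using assms(2) by (rule borel_compact)
  \<comment> \<open>The index set contains 1, so the intersection still lies in
    \<open>prob_measures \<Sigma>\<close>.\<close>
  have Inter: "(\<Inter>\<epsilon>\<in>{0<..}. {P \<in> prob_measures \<Sigma>. D \<epsilon> P \<le> ereal r}) =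
      {P \<in> prob_measures \<Sigma>. \<forall>\<epsilon>>0. D \<epsilon> P \<le> ereal r}" for D :: "real \<Rightarrow> 'a measure \<Rightarrow> ereal"
    using zero_less_one by blast
  have "(\<Inter>\<epsilon>\<in>{0<..}. {P \<in> prob_measures \<Sigma>. KL_W \<Sigma> \<epsilon> P' P \<le> ereal r}) =
      {P \<in> prob_measures \<Sigma>. KL P' P \<le> ereal r}"
    unfolding Inter using KL_W_le_iff[OF \<Sigma> _ assms(7)] by blast
  moreover have "(\<Inter>\<epsilon>\<in>{0<..}. {P \<in> prob_measures \<Sigma>. KL_LP \<Sigma> \<epsilon> P' P \<le> ereal r}) =
      {P \<in> prob_measures \<Sigma>. KL P' P \<le> ereal r}"
    unfolding Inter using KL_LP_le_iff[OF \<Sigma> _ assms(7)] by blast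
  moreover have "{P \<in> prob_measures \<Sigma>. KL P' P \<le> ereal r} \<subseteq> \<A> P'"
    using KL_ball_subset_ambiguity_set[OF assms(1,3-7)] by blast
  ultimately show ?thesis by simp
qed

end
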